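(* Let $P$ be a finite set of points in the Euclidean plane with $|P|$ even, and let $M$ be a $3$-local maximum perfect matching on $P$. Let $M^*$ be a maximum-length perfect matching on $P$. Then $w(M)\geqslant \frac{\sqrt{3}}{2}\, w(M^* )$.
   Context: A perfect matching on a finite point set $P$ in the plane is a partition of $P$ into pairs; each pair $\{a,b\}$ is regarded as the straight-line segment (edge) $ab$. For a set $E$ of segments, $w(E)$ denotes the sum of the Euclidean lengths of its segments. A perfect matching $M$ on $P$ is a maximum-length (globally maximum) matching if $w(M)\geqslant w(M')$ for every perfect matching $M'$ on $P$. For an integer $k$, a perfect matching $M$ is $k$-local maximum if for every subset $M'=\{a_1b_1,\dots,a_kb_k\}$ of $k$ edges of $M$, $M'$ is a maximum-length perfect matching on the point set $\{a_1,b_1,\dots,a_k,b_k\}$.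
   Formalization: 3-local maximum is taken to mean that every subset of at most 3 edges of M is maximum-length on its endpoints; with exactly 3 edges the condition is vacuous for |P|=4 and the claim fails (two opposite sides of a unit square). For |P| at least 6 the two readings are equivalent. *)

theory Defs
  imports "HOL-Analysis.Analysis"
begin

type_synonym point = "real ^ 2"

definition edge_len :: "point set \<Rightarrow> real" where
  "edge_len e = (THE d. \<exists>a b. e = {a, b} \<and> d = dist a b)"

definition w :: "point set set \<Rightarrow> real" where
  "w E = (\<Sum>e\<in>E. edge_len e)"

definition perfect_matching :: "point set \<Rightarrow> point set set \<Rightarrow> bool" where
  "perfect_matching P M \<longleftrightarrow>
     (\<forall>e\<in>M. \<exists>a b. a \<noteq> b \<and> e = {a, b} \<and> a \<in> P \<and> b \<in> P) \<and>
     (\<forall>x\<in>P. \<exists>!e. e \<in> M \<and> x \<in> e)"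

definition max_matching :: "point set \<Rightarrow> point set set \<Rightarrow> bool" where
  "max_matching P M \<longleftrightarrow> perfect_matching P M \<and>
     (\<forall>M'. perfect_matching P M' \<longrightarrow> w M' \<le> w M)"

definition local_max :: "nat \<Rightarrow> point set \<Rightarrow> point set set \<Rightarrow> bool" where
  "local_max k P M \<longleftrightarrow> perfect_matching P M \<and>
     (\<forall>M'. M' \<subseteq> M \<and> card M' \<le> k \<longrightarrow> max_matching (\<Union>M') M')"

end

theory Submission
  imports Defs
begin

text \<open>
  It suffices to find a point \<open>z\<close> with \<open>|az| + |bz| \<le> 2/\<surd>3 |ab|\<close> for every edge \<open>ab\<close> of \<open>M\<close>: then
  \<open>w(M\<^sup>*)\<close> is at most the sum of the distances from \<open>z\<close> to all points, which is at most \<open>2/\<surd>3 w(M)\<close>.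
  Take \<open>z\<close> minimising the largest excess \<open>\<surd>3/2 (|az| + |bz|) - |ab|\<close>. If that excess is positive, the
  gradients of the extremal edges have \<open>0\<close> in their convex hull, and by Caratheodory two or three of
  them are balanced. Seen from \<open>z\<close>, each of these edges subtends an angle below \<open>2\<pi>/3\<close>, while its
  gradient points along the bisector of that angle.

  Two points that \<open>z\<close> sees under an angle of at least \<open>2\<pi>/3\<close> have distance at least
  \<open>\<surd>3/2\<close> times the sum of their distances to \<open>z\<close>. So any rematching all of whose edges are seen under
  such angles is longer than the given edges. Two balanced edges have opposite bisectors and are
  rematched this way. For three, this works unless two of the edges fit together in a sector of
  angle below \<open>2\<pi>/3\<close>; there either the third edge can be swapped with one of the two, or one endpoint
  of each of the two is joined while the other two endpoints are joined to the third edge.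
\<close>

section \<open>Distances in polar coordinates\<close>

text \<open>The law of cosines: the distance of two points at distances \<open>r\<close> and
  \<open>s\<close> from a centre that sees them under the angle \<open>t\<close>.\<close>

definition D :: "real \<Rightarrow> real \<Rightarrow> real \<Rightarrow> real" where
  "D r s t = sqrt (r\<^sup>2 + s\<^sup>2 - 2 * r * s * cos t)"

abbreviation c0 :: real where "c0 \<equiv> sqrt 3 / 2"

text \<open>Both sides are the squared distance when the points lie in directions \<open>a\<close>
  and \<open>a + t\<close>. Since the rotation \<open>a\<close> is free, every projection of the
  segment yields a lower bound for its length that is linear in \<open>r\<close> and
  \<open>s\<close>.\<close>

lemma D_arg:
  fixes r s t a :: real
  shows "r\<^sup>2 + s\<^sup>2 - 2 * r * s * cos t = (r * cos a - s * cos (a + t))\<^sup>2 + (r * sin a - s * sin (a + t))\<^sup>2"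
proof -
  have "cos t = cos a * cos (a + t) + sin a * sin (a + t)"
    using cos_diff[of "a + t" a] by (simp add: mult.commute)
  moreover have "(r * cos a)\<^sup>2 + (r * sin a)\<^sup>2 = r\<^sup>2" "(s * cos (a + t))\<^sup>2 + (s * sin (a + t))\<^sup>2 = s\<^sup>2"
    by (simp_all add: power_mult_distrib flip: distrib_left)
  ultimately show ?thesis by (simp add: power2_diff algebra_simps)
qed

lemma D_support: "r * cos a - s * cos (a + t) \<le> D r s t"
  unfolding D_def D_arg[of r s t a] by (rule real_le_rsqrt) simp

lemma D_commute: "D r s t = D s r t"
  by (simp add: D_def algebra_simps)

lemma D_minus [simp]: "D r s (- t) = D r s t"
  by (simp add: D_def)

lemma D_ge0: "0 \<le> D r s t"
  unfolding D_def D_arg[of r s t 0] by simp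

lemma D_sq: "(D r s t)\<^sup>2 = r\<^sup>2 + s\<^sup>2 - 2 * r * s * cos t"
  unfolding D_def D_arg[of r s t 0] by simp

lemma D_mono_angle:
  assumes "0 \<le> r" "0 \<le> s" "0 \<le> t" "t \<le> t'" "t' \<le> pi"
  shows "D r s t \<le> D r s t'"
proof -
  have "r * s * cos t' \<le> r * s * cos t"
    using assms by (intro mult_left_mono cos_monotone_0_pi_le) auto
  then show ?thesis by (simp add: D_def)
qed

text \<open>Projecting along the segment itself loses nothing: \<open>v\<close> is the oriented
  angle of the triangle at its first endpoint, and the two sine identities are the law of
  sines.\<close>

lemma D_attained:
  assumes "0 < D r s t"
  obtains v where "D r s t = r * cos v - s * cos (v + t)" "r * sin v = s * sin (v + t)" "0 \<le> v" "v < 2 * pi"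
    "D r s t * sin v = s * sin t"
proof -
  let ?X = "r - s * cos t" and ?Y = "s * sin t"
  have sq: "(D r s t)\<^sup>2 = ?X\<^sup>2 + ?Y\<^sup>2"
    using D_arg[of r s t 0] by (simp add: D_sq)
  have "(?X / D r s t)\<^sup>2 + (?Y / D r s t)\<^sup>2 = (?X\<^sup>2 + ?Y\<^sup>2) / (D r s t)\<^sup>2"
    by (simp add: power_divide add_divide_distrib)
  also have "\<dots> = 1"
    unfolding sq[symmetric] using assms by simp
  finally obtain v where v: "0 \<le> v" "v < 2 * pi" "?X / D r s t = cos v" "?Y / D r s t = sin v"
    using sincos_total_2pi by metis
  then have XY: "?X = D r s t * cos v" "?Y = D r s t * sin v"
    using assms by (simp_all add: field_simps)
  have "r * cos v - s * cos (v + t) = ?X * cos v + ?Y * sin v"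
    by (simp add: cos_add algebra_simps)
  also have "\<dots> = D r s t * ((cos v)\<^sup>2 + (sin v)\<^sup>2)"
    unfolding XY by (simp only: power2_eq_square algebra_simps)
  finally have 1: "D r s t = r * cos v - s * cos (v + t)" by simp
  have "r * sin v - s * sin (v + t) = ?X * sin v - ?Y * cos v"
    by (simp add: sin_add algebra_simps)
  also have "\<dots> = 0" unfolding XY by simp
  finally show thesis using 1 v XY(2) by (intro that[of v]) auto
qed

section \<open>Bounds for wide angles; convexity and monotonicity in the radius\<close>

lemma cos_far: assumes "2 * pi / 3 \<le> t" "t \<le> 4 * pi / 3" shows "cos t \<le> - 1 / 2"
proof -
  have *: "cos u \<le> - 1 / 2" if "2 * pi / 3 \<le> u" "u \<le> pi" for u
    using cos_monotone_0_pi_le[of "2 * pi / 3" u] that cos_120 by auto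
  show ?thesis
  proof (cases "t \<le> pi")
    case True then show ?thesis using * assms by blast
  next
    case False
    have "cos (2 * pi - t) \<le> - 1 / 2" by (rule *) (use assms False in auto)
    then show ?thesis by (simp add: cos_diff)
  qed
qed

text \<open>As \<open>cos t \<le> - 1 / 2\<close>, the squared distance is at least
  \<open>r^2 + s^2 + r * s\<close>, which exceeds \<open>3/4 * (r + s)^2\<close> by
  \<open>(r - s)^2 / 4\<close>.\<close>

lemma D_far:
  assumes "0 \<le> r" "0 \<le> s" "2 * pi / 3 \<le> t" "t \<le> 4 * pi / 3"
  shows "c0 * (r + s) \<le> D r s t"
proof -
  have "r * s * cos t \<le> r * s * (- 1 / 2)"
    using assms by (intro mult_left_mono cos_far) auto
  then have "(c0 * (r + s))\<^sup>2 \<le> r\<^sup>2 + s\<^sup>2 - 2 * r * s * cos t"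
    using zero_le_power2[of "r - s"]
    unfolding power_mult_distrib power_divide power2_sum power2_diff by simp
  then show ?thesis unfolding D_def by (rule real_le_rsqrt)
qed

text \<open>The projection angle \<open>pi / 6\<close> gives \<open>r\<close> the coefficient
  \<open>c0\<close>, so that \<open>r\<close> cancels in \<open>D b r t - c0 * r\<close>.\<close>

lemma D_low: "c0 * r - b * cos (t + pi / 6) \<le> D b r t"
  using D_support[of r "pi/6" b t] by (simp add: D_commute[of b r] cos_30 add.commute mult.commute)

text \<open>As a function of \<open>s\<close>, the distance lies above affine functions, one of
  which touches it at the given \<open>s\<close>. That one, with slope \<open>- ?m\<close> after
  subtracting \<open>c * s\<close>, is at least as large at one of the two ends, depending on the
  sign of \<open>?m\<close>.\<close>

lemma D_convex:
  assumes "r \<le> s" "s \<le> u"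
  shows "D x s t - c * s \<le> max (D x r t - c * r) (D x u t - c * u)"
proof (cases "0 < D x s t")
  case True
  then obtain v where v: "D x s t = x * cos v - s * cos (v + t)" by (rule D_attained)
  let ?m = "cos (v + t) + c"
  have "D x s t - c * s = x * cos v - s * ?m" using v by (simp add: algebra_simps)
  also have "\<dots> \<le> max (x * cos v - r * ?m) (x * cos v - u * ?m)"
    using assms mult_right_mono[of r s ?m] mult_right_mono_neg[of s u ?m]
    by (cases "0 \<le> ?m") (auto simp: max_def)
  also have "\<dots> \<le> max (D x r t - c * r) (D x u t - c * u)"
    using D_support[of x v r t] D_support[of x v u t] by (auto simp: algebra_simps)
  finally show ?thesis .
next
  case False
  then have "D x s t - c * s \<le> - c * s" by simp
  also have "\<dots> \<le> max (- c * r) (- c * u)"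
  proof (cases "0 \<le> c")
    case True
    then show ?thesis using mult_left_mono[OF assms(1), of c] by simp
  next
    case False
    then show ?thesis using mult_left_mono_neg[OF assms(2), of c] by (simp add: le_max_iff_disj)
  qed
  also have "\<dots> \<le> max (D x r t - c * r) (D x u t - c * u)"
    using D_ge0[of x r t] D_ge0[of x u t] by (auto simp: max_def)
  finally show ?thesis .
qed

text \<open>The derivative of \<open>D x s t\<close> in \<open>s\<close> is
  \<open>(s - x * cos t) / D x s t\<close>; \<open>slope\<close> bounds it by \<open>c0\<close> for
  \<open>s \<le> x\<close> and angles up to \<open>2 * pi / 3\<close>.\<close>

lemma D_antimono:
  assumes "0 \<le> r" "r \<le> r'" "r' \<le> x" "0 \<le> t" "t \<le> 2 * pi / 3"
  shows "D x r' t - c0 * r' \<le> D x r t - c0 * r"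
proof -
  let ?C = "cos t"
  have C: "- 1 / 2 \<le> ?C" "?C \<le> 1"
    using cos_monotone_0_pi_le[of t "2 * pi / 3"] assms cos_120 by auto
  have slope: "s - x * ?C \<le> c0 * D x s t" if s: "0 \<le> s" "s \<le> x" for s
  proof (cases "0 \<le> s - x * ?C")
    case True
    have "(s - x * ?C)\<^sup>2 \<le> (x * (1 - ?C))\<^sup>2"
      using True s by (intro power_mono) (auto simp: algebra_simps)
    also have "\<dots> \<le> 3 * (x\<^sup>2 * ((1 - ?C) * (1 + ?C)))"
    proof -
      have "x\<^sup>2 * (1 - ?C) * (1 - ?C) \<le> x\<^sup>2 * (1 - ?C) * (3 * (1 + ?C))"
        using C by (intro mult_left_mono mult_nonneg_nonneg) auto
      then show ?thesis by (simp add: power2_eq_square algebra_simps)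
    qed
    finally have "(s - x * ?C)\<^sup>2 \<le> 3 / 4 * (x\<^sup>2 + s\<^sup>2 - 2 * x * s * ?C)"
      by (simp add: power2_eq_square algebra_simps)
    also have "\<dots> = (c0 * D x s t)\<^sup>2"
      by (simp add: power_mult_distrib D_sq power_divide)
    finally show ?thesis by (rule power2_le_imp_le) (simp add: D_ge0)
  next
    case False
    then show ?thesis using D_ge0[of x s t] by (smt (verit) mult_nonneg_nonneg real_sqrt_ge_zero divide_nonneg_nonneg)
  qed
  \<comment> \<open>The squared distance is quadratic in the radius, so the slope bound at the two
    ends replaces a mean value argument.\<close>
  have "(D x r' t - D x r t) * (D x r' t + D x r t) = (r' - r) * ((r' - x * ?C) + (r - x * ?C))"
    using D_sq[of x r' t] D_sq[of x r t] by (simp add: power2_eq_square algebra_simps)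
  also have "\<dots> \<le> (r' - r) * (c0 * D x r' t + c0 * D x r t)"
    using assms by (intro mult_left_mono add_mono slope) auto
  finally have *: "(D x r' t - D x r t) * (D x r' t + D x r t) \<le> (c0 * (r' - r)) * (D x r' t + D x r t)"
    unfolding distrib_left[symmetric] by (simp only: mult_ac)
  show ?thesis
  proof (cases "0 < D x r' t + D x r t")
    case True
    then have "D x r' t - D x r t \<le> c0 * (r' - r)" using * mult_right_le_imp_le by blast
    then show ?thesis by (simp add: algebra_simps)
  next
    case False
    then have "D x r' t = 0" "D x r t = 0" using D_ge0[of x r' t] D_ge0[of x r t] by linarith+
    then show ?thesis using assms by simp
  qed
qed

text \<open>A substitute for \<open>D_antimono\<close> beyond radius \<open>b\<close>, paid for by
  the angle \<open>4 * h\<close>. By convexity on the interval from \<open>b\<close> to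
  \<open>r\<close>, it suffices to compare at the ends: at \<open>r\<close> by monotonicity in the
  angle, at \<open>b\<close> by the chord length \<open>2 * b * sin h\<close> and
  \<open>D_low\<close>.\<close>

lemma D_diff_le_wide:
  assumes "0 < b" "b \<le> a" "a \<le> r" "0 \<le> h" "4 * h \<le> t" "t \<le> 2 * pi / 3"
  shows "D b a (2 * h) - c0 * a \<le> D b r t - c0 * r"
proof -
  have "D b b (2 * h) = 2 * b * sin h"
  proof -
    have "b\<^sup>2 + b\<^sup>2 - 2 * b * b * cos (2 * h) = (2 * b * sin h)\<^sup>2"
      unfolding cos_double_sin by (simp add: power2_eq_square algebra_simps)
    moreover have "0 \<le> 2 * b * sin h"
      using assms by (intro mult_nonneg_nonneg sin_ge_zero) auto
    ultimately show ?thesis by (simp add: D_def)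
  qed
  \<comment> \<open>The worst case is \<open>t = 4 * h\<close>. There, dividing by
    \<open>2 * sin h\<close> leaves \<open>1 \<le> 2 * sin (pi / 6 + 2 * h) * cos h\<close>, a sum
    of two sines that are each at least \<open>1 / 2\<close>.\<close>
  moreover have "2 * sin h - c0 \<le> - cos (t + pi / 6)"
  proof -
    have "1 \<le> sin (pi / 6 + 3 * h) + sin (pi / 6 + h)"
    proof -
      have "1 / 2 \<le> sin (pi / 6 + x)" if "0 \<le> x" "x \<le> 2 * pi / 3" for x
      proof -
        have "cos (pi / 3) \<le> cos \<bar>pi / 3 - x\<bar>"
          using that by (intro cos_monotone_0_pi_le) (auto simp: abs_if)
        then show ?thesis by (simp add: cos_60 sin_cos_eq algebra_simps)
      qed
      from this[of "3 * h"] this[of h] show ?thesis using assms by auto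
    qed
    also have "\<dots> = 2 * (sin (pi / 6 + 2 * h) * cos h)"
      using sin_add[of "pi / 6 + 2 * h" h] sin_diff[of "pi / 6 + 2 * h" h] by (simp add: algebra_simps)
    finally have "2 * sin h * 1 \<le> 2 * sin h * (2 * (sin (pi / 6 + 2 * h) * cos h))"
      using assms by (intro mult_left_mono mult_nonneg_nonneg sin_ge_zero) auto
    also have "\<dots> = 2 * sin (pi / 6 + 2 * h) * sin (2 * h)"
      by (simp add: sin_double)
    also have "\<dots> = cos (pi / 6) - cos (4 * h + pi / 6)"
      using cos_add[of "pi / 6 + 2 * h" "2 * h"] cos_diff[of "pi / 6 + 2 * h" "2 * h"] by (simp add: algebra_simps)
    also have "\<dots> \<le> cos (pi / 6) - cos (t + pi / 6)"
      using assms by (intro diff_left_mono cos_monotone_0_pi_le) auto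
    finally show ?thesis by (simp add: cos_30)
  qed
  then have "b * (2 * sin h - c0) \<le> b * (- cos (t + pi / 6))"
    using assms by (intro mult_left_mono) auto
  ultimately have "D b b (2 * h) - c0 * b \<le> D b r t - c0 * r"
    using D_low[of r b t] by (simp add: algebra_simps)
  moreover have "D b r (2 * h) \<le> D b r t"
    using assms by (intro D_mono_angle) auto
  ultimately show ?thesis
    using D_convex[OF assms(2,3), of b "2 * h" c0] by linarith
qed

text \<open>
  The right-hand side bounds from below the gain of joining \<open>a\<close> and \<open>b\<close> to two further points seen under
  angles that exceed, respectively fall short of, \<open>2\<pi>/3\<close> by \<open>d\<close>. The proof compares with the
  angle \<open>v\<close> at \<open>a\<close> in the triangle with vertex angle \<open>2h\<close>.
\<close>

lemma D_le_split:
  assumes "0 < b" "b \<le> a" "0 \<le> h" "h < pi / 3" "0 \<le> d" "d \<le> 2 * h" "d \<le> pi / 3 - h"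
    and short: "D a b (2 * h) < c0 * (a + b)"
  shows "D a b (2 * h) \<le> a * cos (max 0 (pi / 6 - d)) + b * cos (pi / 6 + d)"
proof (cases "d = 0")
  case True
  then show ?thesis using short by (simp add: cos_30 algebra_simps)
next
  case False
  with assms have d: "0 < d" and h: "0 < h" by auto
  have sin2: "0 < sin (2 * h)" using h assms by (intro sin_gt_zero) auto
  have cos2: "cos (2 * h) < 1" using cos_monotone_0_pi[of 0 "2 * h"] h assms by auto
  have "0 < D a b (2 * h)"
  proof -
    have "0 < (b * sin (2 * h))\<^sup>2" using assms sin2 by simp
    then show ?thesis unfolding D_def D_arg[of a b "2 * h" 0] by (simp add: add_nonneg_pos)
  qed
  then obtain v where v: "D a b (2 * h) = a * cos v - b * cos (v + 2 * h)" "a * sin v = b * sin (v + 2 * h)"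
      "0 \<le> v" "v < 2 * pi" and Dv: "D a b (2 * h) * sin v = b * sin (2 * h)"
    by (rule D_attained)
  have sv: "0 < sin v"
  proof -
    have "0 < D a b (2 * h) * sin v" using Dv sin2 assms by simp
    then show ?thesis using \<open>0 < D a b (2 * h)\<close> by (simp add: zero_less_mult_iff)
  qed
  have vpi: "0 < v" "v < pi"
    using sv v(3,4) sin_le_zero[of v] by (cases "v = 0", auto intro: ccontr)
  have sv2: "0 < sin (v + 2 * h)"
  proof -
    have "0 < b * sin (v + 2 * h)" using v(2) sv assms by (metis mult_pos_pos less_le_trans)
    then show ?thesis using assms by (simp add: zero_less_mult_iff)
  qed
  have v2: "v + 2 * h < pi"
    using sv2 sin_le_zero[of "v + 2 * h"] vpi assms by (cases "v + 2 * h < pi") auto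
  \<comment> \<open>The shorter side \<open>b\<close> is opposite the smaller angle, so
    \<open>v\<close> is at most the base angle \<open>pi / 2 - h\<close> of the isosceles
    triangle.\<close>
  have "sin v \<le> sin (v + 2 * h)"
  proof -
    have "b * sin v \<le> b * sin (v + 2 * h)" using v(2) sv assms by (metis less_imp_le mult_right_mono)
    then show ?thesis using assms by simp
  qed
  then have "0 \<le> cos (v + h) * sin h"
    using sin_add[of "v + h" h] sin_diff[of "v + h" h] by (simp add: algebra_simps)
  moreover have "0 < sin h" using h assms by (intro sin_gt_zero) auto
  ultimately have "0 \<le> cos (v + h)" by (simp add: zero_le_mult_iff)
  have vh: "v \<le> pi / 2 - h"
  proof (rule ccontr)
    assume "\<not> v \<le> pi / 2 - h"
    then have "cos (v + h) < cos (pi / 2)" using vpi v2 h by (intro cos_monotone_0_pi) auto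
    then show False using \<open>0 \<le> cos (v + h)\<close> by simp
  qed
  show ?thesis
  proof (cases "pi / 6 - d \<le> v")
    case True
    \<comment> \<open>Here the two summands are compared separately; the angle at \<open>b\<close>
      is at least \<open>pi / 2 - h\<close>, hence at least \<open>pi / 6 + d\<close>.\<close>
    have "cos v \<le> cos (max 0 (pi / 6 - d))"
      using True vpi by (intro cos_monotone_0_pi_le) auto
    moreover have "cos (pi - (v + 2 * h)) \<le> cos (pi / 6 + d)"
      using vh vpi v2 assms by (intro cos_monotone_0_pi_le) auto
    ultimately show ?thesis
      using v(1) assms by (smt (verit) cos_pi_minus mult_left_mono mult_minus_right)
  next
    case small: False
    then have dle: "d \<le> pi / 6" using vpi by auto
    \<comment> \<open>Here the claim follows from \<open>short\<close> once turning by
      \<open>d\<close> gains at least as much at \<open>a\<close> as it loses at \<open>b\<close>.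
      By sum-to-product this is
      \<open>b * sin (pi / 6 + d / 2) \<le> a * sin (pi / 6 - d / 2)\<close>, and the law of sines
      turns it into a comparison of sine products.\<close>
    have cross: "sin (v + d) * sin (pi / 6 - d / 2) - sin v * sin (pi / 6 + d / 2)
        = (cos (pi / 6 - v - 3 * d / 2) - cos (pi / 6 - v + d / 2)) / 2"
      using cos_diff[of "v + d" "pi / 6 - d / 2"] cos_add[of "v + d" "pi / 6 - d / 2"]
        cos_diff[of v "pi / 6 + d / 2"] cos_add[of v "pi / 6 + d / 2"]
        cos_minus[of "pi / 6 - v - 3 * d / 2"] cos_minus[of "pi / 6 - v + d / 2"]
      by (simp add: algebra_simps)
    have "cos (pi / 6 - v + d / 2) \<le> cos \<bar>pi / 6 - v - 3 * d / 2\<bar>"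
      using small vpi d dle by (intro cos_monotone_0_pi_le) (auto simp: abs_if)
    then have "sin v * sin (pi / 6 + d / 2) \<le> sin (v + d) * sin (pi / 6 - d / 2)"
      using cross by simp
    also have "\<dots> \<le> sin (v + 2 * h) * sin (pi / 6 - d / 2)"
    proof (rule mult_right_mono)
      have "cos (pi / 2 - (v + d)) \<le> cos \<bar>pi / 2 - (v + 2 * h)\<bar>"
        using small vh vpi assms dle by (intro cos_monotone_0_pi_le) (auto simp: abs_if)
      then show "sin (v + d) \<le> sin (v + 2 * h)" by (simp add: sin_cos_eq)
      show "0 \<le> sin (pi / 6 - d / 2)" using d dle by (intro sin_ge_zero) auto
    qed
    finally have "b * (sin v * sin (pi / 6 + d / 2)) \<le> b * (sin (v + 2 * h) * sin (pi / 6 - d / 2))"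
      using assms by (intro mult_left_mono) auto
    also have "\<dots> = a * sin v * sin (pi / 6 - d / 2)" using v(2) by simp
    finally have "(b * sin (pi / 6 + d / 2)) * sin v \<le> (a * sin (pi / 6 - d / 2)) * sin v"
      by (simp add: algebra_simps)
    then have "b * sin (pi / 6 + d / 2) \<le> a * sin (pi / 6 - d / 2)" using sv by simp
    then have "2 * sin (d / 2) * (b * sin (pi / 6 + d / 2)) \<le> 2 * sin (d / 2) * (a * sin (pi / 6 - d / 2))"
      using d dle by (intro mult_left_mono mult_nonneg_nonneg sin_ge_zero) auto
    moreover have "cos (pi / 6) - cos (pi / 6 + d) = 2 * sin (d / 2) * sin (pi / 6 + d / 2)"
      using cos_diff_cos[of "pi / 6" "pi / 6 + d"] by (simp add: add_divide_distrib mult.commute)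
    moreover have "cos (pi / 6 - d) - cos (pi / 6) = 2 * sin (d / 2) * sin (pi / 6 - d / 2)"
      using cos_diff_cos[of "pi / 6 - d" "pi / 6"] by (simp add: diff_divide_distrib mult.commute)
    ultimately have "b * (c0 - cos (pi / 6 + d)) \<le> a * (cos (pi / 6 - d) - c0)"
      by (simp add: cos_30 algebra_simps)
    then show ?thesis using short dle by (simp add: max_def algebra_simps)
  qed
qed

section \<open>Two edges in a narrow sector\<close>

text \<open>
  Four rays in angular order with gaps \<open>2 h1\<close>, \<open>I\<close>, \<open>2 h2\<close> carry the outer and inner endpoints
  \<open>o1, i1, i2, o2\<close> of two edges. The four inequalities with \<open>c0\<close> say that joining one endpoint of
  each edge, and the other two to far points of a third edge, is no improvement. Up to the terms that
  cancel they compare values of \<open>\<lambda>r. D x r t - c0 * r\<close>, a convex function, decreasing for \<open>r \<le> x\<close>;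
  the cases are governed by how the intervals between \<open>i1, o1\<close> and between \<open>i2, o2\<close> interleave.
\<close>

lemma fan_impossible_aux:
  fixes x1 y1 x2 y2 :: real
  assumes pos: "0 < o1" "0 < i1" "0 < i2" "0 < o2"
    and h: "0 \<le> h1" "0 \<le> h2" "0 \<le> I" "I + 2 * h1 + 2 * h2 \<le> 2 * pi / 3"
    and short: "D o1 i1 (2 * h1) < c0 * (o1 + i1)" "D o2 i2 (2 * h2) < c0 * (o2 + i2)"
    and ii: "D i1 i2 I + c0 * (o1 + o2) < D o1 i1 (2 * h1) + D o2 i2 (2 * h2)"
    and io: "D i1 o2 (I + 2 * h2) + c0 * (o1 + i2) < D o1 i1 (2 * h1) + D o2 i2 (2 * h2)"
    and oi: "D o1 i2 (I + 2 * h1) + c0 * (i1 + o2) < D o1 i1 (2 * h1) + D o2 i2 (2 * h2)"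
    and oo: "D o1 o2 (I + 2 * h1 + 2 * h2) + c0 * (i1 + i2) < D o1 i1 (2 * h1) + D o2 i2 (2 * h2)"
    and good1: "\<lbrakk>i1 \<le> o1; I \<le> 2 * h1; I \<le> 2 * h2\<rbrakk> \<Longrightarrow> False"
    and good2: "\<lbrakk>i2 \<le> o2; I \<le> 2 * h1; I \<le> 2 * h2\<rbrakk> \<Longrightarrow> False"
    and larger: "max i2 o2 \<le> max i1 o1"
  shows False
proof -
  have comm: "D i1 o1 t = D o1 i1 t" "D i2 o2 t = D o2 i2 t" "D i2 i1 t = D i1 i2 t"
    "D o2 i1 t = D i1 o2 t" "D i2 o1 t = D o1 i2 t" "D o2 o1 t = D o1 o2 t" for t
    by (simp_all add: D_commute)
  \<comment> \<open>Bounding the length of one edge by \<open>short\<close> cancels its terms: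
    \<open>F1\<close> eliminates the second edge, \<open>F2\<close> the first, and each line
    compares two radii seen from one common endpoint.\<close>
  have F1: "D i1 i2 I - c0 * i2 < D i1 o1 (2 * h1) - c0 * o1"
    "D i1 o2 (I + 2 * h2) - c0 * o2 < D i1 o1 (2 * h1) - c0 * o1"
    "D o1 i2 (I + 2 * h1) - c0 * i2 < D o1 i1 (2 * h1) - c0 * i1"
    "D o1 o2 (I + 2 * h1 + 2 * h2) - c0 * o2 < D o1 i1 (2 * h1) - c0 * i1"
    using ii io oi oo short(2) unfolding comm distrib_left by linarith+
  have F2: "D i2 i1 I - c0 * i1 < D i2 o2 (2 * h2) - c0 * o2"
    "D o2 i1 (I + 2 * h2) - c0 * i1 < D o2 i2 (2 * h2) - c0 * i2"
    "D i2 o1 (I + 2 * h1) - c0 * o1 < D i2 o2 (2 * h2) - c0 * o2"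
    "D o2 o1 (I + 2 * h1 + 2 * h2) - c0 * o1 < D o2 i2 (2 * h2) - c0 * i2"
    using ii io oi oo short(1) unfolding comm distrib_left by linarith+
  have between: False
    if "0 < x" "0 < r" "0 < s" "0 < u" "r \<le> s" "s \<le> u" "0 \<le> t" "t \<le> tr" "t \<le> tu" "tr \<le> pi" "tu \<le> pi"
      "D x r tr - c0 * r < D x s t - c0 * s" "D x u tu - c0 * u < D x s t - c0 * s"
    for x r s u t tr tu
    using D_convex[of r s u x t c0] D_mono_angle[of x r t tr] D_mono_angle[of x u t tu] that by auto
  have smaller: False
    if "0 < r" "r \<le> s" "s \<le> x" "0 \<le> t" "t \<le> t'" "t' \<le> 2 * pi / 3"
      "D x r t' - c0 * r < D x s t - c0 * s" for x r s t t'
    using D_antimono[of r s x t] D_mono_angle[of x r t t'] that by auto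
  have Q1: "\<not> (min i2 o2 \<le> i1 \<and> i1 \<le> max i2 o2)"
  proof
    assume "min i2 o2 \<le> i1 \<and> i1 \<le> max i2 o2"
    then consider "i2 \<le> i1" "i1 \<le> o2" | "o2 \<le> i1" "i1 \<le> i2" by (auto simp: min_def max_def split: if_splits)
    then show False
      using between[of o1 i2 i1 o2 "2 * h1" "I + 2 * h1" "I + 2 * h1 + 2 * h2"]
        between[of o1 o2 i1 i2 "2 * h1" "I + 2 * h1 + 2 * h2" "I + 2 * h1"] F1(3,4) pos h
      by cases auto
  qed
  have Q2: "\<not> (min i1 o1 \<le> i2 \<and> i2 \<le> max i1 o1)"
  proof
    assume "min i1 o1 \<le> i2 \<and> i2 \<le> max i1 o1"
    then consider "i1 \<le> i2" "i2 \<le> o1" | "o1 \<le> i2" "i2 \<le> i1" by (auto simp: min_def max_def split: if_splits)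
    then show False
      using between[of o2 i1 i2 o1 "2 * h2" "I + 2 * h2" "I + 2 * h1 + 2 * h2"]
        between[of o2 o1 i2 i1 "2 * h2" "I + 2 * h1 + 2 * h2" "I + 2 * h2"] F2(2,4) pos h
      by cases auto
  qed
  \<comment> \<open>\<open>Q2\<close> and \<open>larger\<close> put \<open>i2\<close> below both
    \<open>i1\<close> and \<open>o1\<close>; then \<open>Q1\<close> puts \<open>i1\<close> above
    both \<open>i2\<close> and \<open>o2\<close>. Only the position of \<open>o1\<close> relative to
    \<open>o2\<close> remains open.\<close>
  consider (below) "max i2 o2 < min i1 o1" | (shifted) "i2 < o1" "o1 \<le> o2" "o2 \<le> i1"
    using Q1 Q2 larger by (cases "o1 \<le> o2") (auto simp: min_def max_def split: if_splits)
  then show False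
  proof cases
    case below
    show False
    proof (cases "i1 \<le> o1")
      case True
      then show False
        using smaller[of i2 i1 o1 "2 * h1" "I + 2 * h1"] below pos h F1(3) by auto
    next
      case bad1: False
      show False
      proof (cases "2 * h1 \<le> I + 2 * h2")
        case True
        then show False
          using smaller[of o2 o1 i1 "2 * h1" "I + 2 * h2"] below pos h F1(2) bad1 by auto
      next
        \<comment> \<open>The first edge now subtends more than \<open>I + 2 * h2\<close>, which
          leaves room for the angle \<open>4 * h2\<close> in \<open>D_diff_le_wide\<close>, applied
          from the nearer endpoint of the second edge.\<close>
        case far1: False
        show False
        proof (cases "i2 \<le> o2")
          case good: True
          then have "\<not> I \<le> 2 * h2" using good2 far1 h by auto
          then show False
            using D_diff_le_wide[of i2 o2 o1 h2 "I + 2 * h1"] good below far1 pos h F2(3) by auto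
        next
          case False
          then show False
            using D_diff_le_wide[of o2 i2 o1 h2 "I + 2 * h1 + 2 * h2"] below far1 pos h F2(4) by auto
        qed
      qed
    qed
  next
    case shifted
    show False
    proof (cases "2 * h1 \<le> I")
      case True
      then show False
        using smaller[of i2 o1 i1 "2 * h1" I] shifted pos h F1(1) by auto
    next
      case False
      then have "2 * h2 \<le> I" using good2 shifted by (meson le_less_trans less_imp_le not_le order_trans)
      then show False
        using between[of i2 o1 o2 i1 "2 * h2" "I + 2 * h1" I] shifted pos h F2(1,3) by auto
    qed
  qed
qed

text \<open>A reflection reverses the order of the rays and exchanges the edges, so the edge with
  the farthest endpoint may be taken as the first.\<close>

lemma fan_impossible:
  fixes o1 i1 i2 o2 :: real
  assumes pos: "0 < o1" "0 < i1" "0 < i2" "0 < o2"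
    and h: "0 \<le> h1" "0 \<le> h2" "0 \<le> I" "I + 2 * h1 + 2 * h2 \<le> 2 * pi / 3"
    and short: "D o1 i1 (2 * h1) < c0 * (o1 + i1)" "D o2 i2 (2 * h2) < c0 * (o2 + i2)"
    and T: "D i1 i2 I + c0 * (o1 + o2) < D o1 i1 (2 * h1) + D o2 i2 (2 * h2)"
      "D i1 o2 (I + 2 * h2) + c0 * (o1 + i2) < D o1 i1 (2 * h1) + D o2 i2 (2 * h2)"
      "D o1 i2 (I + 2 * h1) + c0 * (i1 + o2) < D o1 i1 (2 * h1) + D o2 i2 (2 * h2)"
      "D o1 o2 (I + 2 * h1 + 2 * h2) + c0 * (i1 + i2) < D o1 i1 (2 * h1) + D o2 i2 (2 * h2)"
    and good1: "\<lbrakk>i1 \<le> o1; I \<le> 2 * h1; I \<le> 2 * h2\<rbrakk> \<Longrightarrow> False"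
    and good2: "\<lbrakk>i2 \<le> o2; I \<le> 2 * h1; I \<le> 2 * h2\<rbrakk> \<Longrightarrow> False"
  shows False
proof (cases "max i2 o2 \<le> max i1 o1")
  case True
  then show False using assms fan_impossible_aux[of o1 i1 i2 o2 h1 h2 I] by blast
next
  case False
  show False
  proof (rule fan_impossible_aux[of o2 i2 i1 o1 h2 h1 I])
    show "D i2 i1 I + c0 * (o2 + o1) < D o2 i2 (2 * h2) + D o1 i1 (2 * h1)"
      using T(1) by (simp add: D_commute add.commute)
    show "D i2 o1 (I + 2 * h1) + c0 * (o2 + i1) < D o2 i2 (2 * h2) + D o1 i1 (2 * h1)"
      using T(3) by (simp add: D_commute[of i2] add.commute)
    show "D o2 i1 (I + 2 * h2) + c0 * (i2 + o1) < D o2 i2 (2 * h2) + D o1 i1 (2 * h1)"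
      using T(2) by (simp add: D_commute[of o2 i1] add.commute)
    show "D o2 o1 (I + 2 * h2 + 2 * h1) + c0 * (i2 + i1) < D o2 i2 (2 * h2) + D o1 i1 (2 * h1)"
      using T(4) by (simp add: D_commute[of o2 o1] add_ac)
  qed (use assms False in auto)
qed

text \<open>A surplus angle \<open>d\<close> beyond \<open>2 * pi / 3\<close> improves the
  coefficient of \<open>a\<close> from \<open>c0\<close> to \<open>cos (max 0 (pi / 6 - d))\<close>.
  The sign of the projection angle \<open>v\<close> keeps \<open>v + t\<close> within
  \<open>pi / 6\<close> of \<open>pi\<close>, so \<open>p\<close> retains the coefficient
  \<open>c0\<close>.\<close>

lemma D_beyond:
  assumes "0 < p" "0 \<le> d" "2 * pi / 3 + d \<le> t" "t \<le> 4 * pi / 3 - d"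
  shows "c0 * p + a * cos (max 0 (pi / 6 - d)) \<le> D a p t"
proof -
  define e where "e = max 0 (pi / 6 - d)"
  define v where "v = (if t \<le> pi then e else - e)"
  have "\<bar>pi - (v + t)\<bar> \<le> pi / 6"
    unfolding v_def e_def max_def abs_le_iff using assms by auto
  then have "cos (pi / 6) \<le> cos \<bar>pi - (v + t)\<bar>"
    by (intro cos_monotone_0_pi_le) auto
  then have "c0 \<le> - cos (v + t)" by (simp add: cos_30)
  then have "p * c0 \<le> p * - cos (v + t)"
    using assms by (intro mult_left_mono) auto
  moreover have "cos v = cos e" by (simp add: v_def)
  ultimately show ?thesis using D_support[of a v p t] by (simp add: e_def algebra_simps)
qed

section \<open>Edges around a common centre\<close>

text \<open>Equality of angles modulo \<open>2 * pi\<close>, encoded without integer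
  multiples.\<close>

definition same_dir :: "real \<Rightarrow> real \<Rightarrow> bool" where
  "same_dir x y \<longleftrightarrow> sin x = sin y \<and> cos x = cos y"

lemma same_dir_D: "same_dir x y \<Longrightarrow> D r s (x + z) = D r s (y + z)"
  by (simp add: D_def same_dir_def cos_add)

abbreviation side :: "bool \<Rightarrow> real \<Rightarrow> real" where
  "side b x \<equiv> (if b then x else - x)"

text \<open>
  Edge \<open>i\<close> has its \<open>True\<close> endpoint in direction \<open>B i + h i\<close> and its \<open>False\<close> endpoint in direction
  \<open>B i - h i\<close>, at distances \<open>R i True\<close> and \<open>R i False\<close> from the centre; \<open>L\<close> is the distance between
  endpoints.
\<close>

locale star =
  fixes K :: "'e set" and R :: "'e \<Rightarrow> bool \<Rightarrow> real" and B h :: "'e \<Rightarrow> real"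
    and L :: "'e \<Rightarrow> bool \<Rightarrow> 'e \<Rightarrow> bool \<Rightarrow> real"
  assumes L_def: "L i b j c = D (R i b) (R j c) (B j + side c (h j) - (B i + side b (h i)))"
    and R_pos: "i \<in> K \<Longrightarrow> 0 < R i b"
    and h_range: "i \<in> K \<Longrightarrow> 0 \<le> h i \<and> h i < pi / 3"
    and short: "i \<in> K \<Longrightarrow> L i True i False < c0 * (R i True + R i False)"
    and opt2: "\<lbrakk>i \<in> K; j \<in> K; i \<noteq> j\<rbrakk> \<Longrightarrow>
      L i True j b + L i False j (\<not> b) \<le> L i True i False + L j True j False"
    and opt3: "\<lbrakk>i \<in> K; j \<in> K; k \<in> K; i \<noteq> j; j \<noteq> k; k \<noteq> i\<rbrakk> \<Longrightarrow>
      L i a j b + L j (\<not> b) k c + L k (\<not> c) i (\<not> a) \<le> L i True i False + L j True j False + L k True k False"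
begin

lemma L_gap: "same_dir (B j - B i) g \<Longrightarrow> L i b j c = D (R i b) (R j c) (g + (side c (h j) - side b (h i)))"
  using same_dir_D[of "B j - B i" g "R i b" "R j c" "side c (h j) - side b (h i)"]
  by (simp add: L_def algebra_simps)

lemma L_self: "L i True i False = D (R i True) (R i False) (2 * h i)"
  using D_minus[of "R i True" "R i False" "2 * h i"] by (simp add: L_def)

lemma L_far:
  assumes "i \<in> K" "j \<in> K" "same_dir (B j - B i) g"
    "2 * pi / 3 \<le> g + (side c (h j) - side b (h i))" "g + (side c (h j) - side b (h i)) \<le> 4 * pi / 3"
  shows "c0 * (R i b + R j c) \<le> L i b j c"
  unfolding L_gap[OF assms(3)] using assms R_pos by (intro D_far) (auto simp: less_imp_le)

text \<open>Joining endpoints with equal labels gives the angles \<open>g + (h j - h i)\<close> and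
  \<open>g - (h j - h i)\<close>. Both are in the range of \<open>D_far\<close>, so the swap would
  be longer.\<close>

lemma parallel_swap:
  assumes ij: "i \<in> K" "j \<in> K" "i \<noteq> j" "same_dir (B j - B i) g"
    and g: "g \<le> pi" "2 * pi / 3 + \<bar>h i - h j\<bar> \<le> g"
  shows False
proof -
  have "\<bar>h i - h j\<bar> \<le> pi / 3" using h_range[OF ij(1)] h_range[OF ij(2)] unfolding abs_le_iff by linarith
  then have "c0 * (R i True + R j True) \<le> L i True j True" "c0 * (R i False + R j False) \<le> L i False j False"
    using g by (intro L_far[OF ij(1,2,4)]; simp add: abs_le_iff)+
  then show False
    using opt2[OF ij(1-3), of True] short[OF ij(1)] short[OF ij(2)]
    unfolding distrib_left by simp
qed

lemma L_sym: "L i b j c = L j c i b"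
  unfolding L_def by (subst D_commute, subst D_minus[symmetric]) (simp only: minus_diff_eq)

text \<open>One new edge has at least the surplus angle \<open>d\<close>, the other falls short by
  \<open>d\<close>. Since the surplus is at the farther endpoint of \<open>i\<close>,
  \<open>D_le_split\<close> shows that the bounds from \<open>D_beyond\<close> and
  \<open>D_low\<close> still add up to more than the old edges.\<close>

lemma tilted_swap:
  assumes K: "i \<in> K" "k \<in> K" "i \<noteq> k"
    and far: "L i b k c = D (R i b) (R k c) t" "2 * pi / 3 + d \<le> t" "t \<le> 4 * pi / 3 - d"
    and near: "L i (\<not> b) k (\<not> c) = D (R i (\<not> b)) (R k (\<not> c)) (2 * pi / 3 - d)"
    and big: "R i (\<not> b) \<le> R i b" and d: "0 \<le> d" "d \<le> 2 * h i" "d \<le> pi / 3 - h i"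
  shows False
proof -
  have self: "L i True i False = D (R i b) (R i (\<not> b)) (2 * h i)"
    by (cases b) (simp_all add: L_self D_commute)
  have "D (R i b) (R i (\<not> b)) (2 * h i) < c0 * (R i b + R i (\<not> b))"
    using short[OF K(1)] unfolding self by (cases b) (simp_all add: add.commute)
  then have "L i True i False \<le> R i b * cos (max 0 (pi / 6 - d)) + R i (\<not> b) * cos (pi / 6 + d)"
    unfolding self using big d R_pos[OF K(1)] h_range[OF K(1)] by (intro D_le_split) auto
  moreover have "c0 * R k c + R i b * cos (max 0 (pi / 6 - d)) \<le> L i b k c"
    unfolding far(1) using far(2,3) d R_pos[OF K(2)] by (intro D_beyond) auto
  moreover have "c0 * R k (\<not> c) + R i (\<not> b) * cos (pi / 6 + d) \<le> L i (\<not> b) k (\<not> c)"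
  proof -
    have "cos (2 * pi / 3 - d + pi / 6) = - cos (pi / 6 + d)"
      using cos_pi_minus[of "pi / 6 + d"] by (simp add: algebra_simps)
    then show ?thesis
      unfolding near using D_low[of "R k (\<not> c)" "R i (\<not> b)" "2 * pi / 3 - d"] by simp
  qed
  moreover have "L i b k c + L i (\<not> b) k (\<not> c) \<le> L i True i False + L k True k False"
    using opt2[OF K, of c] opt2[OF K, of "\<not> c"] by (cases b) (simp_all add: add.commute)
  moreover have "L k True k False < c0 * R k c + c0 * R k (\<not> c)"
    using short[OF K(2)] by (cases c) (simp_all add: algebra_simps)
  ultimately show False by linarith
qed

text \<open>The bisectors go once around the centre and do not fit into an open half-plane;
  nonnegative gaps follow from the bounds by \<open>pi\<close> and the total
  \<open>2 * pi\<close>.\<close>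

definition gap_triple :: "'e \<Rightarrow> 'e \<Rightarrow> 'e \<Rightarrow> real \<Rightarrow> real \<Rightarrow> real \<Rightarrow> bool" where
  "gap_triple i j k g1 g2 g3 \<longleftrightarrow> i \<in> K \<and> j \<in> K \<and> k \<in> K \<and> i \<noteq> j \<and> j \<noteq> k \<and> k \<noteq> i \<and>
     same_dir (B j - B i) g1 \<and> same_dir (B k - B j) g2 \<and> same_dir (B i - B k) g3 \<and>
     g1 \<le> pi \<and> g2 \<le> pi \<and> g3 \<le> pi \<and> g1 + g2 + g3 = 2 * pi"

lemma gap_triple_rotate: "gap_triple i j k g1 g2 g3 \<Longrightarrow> gap_triple j k i g2 g3 g1"
  by (auto simp: gap_triple_def)

lemma gap_triple_less:
  assumes "gap_triple i j k g1 g2 g3"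
  shows "g1 < 2 * pi / 3 + \<bar>h i - h j\<bar>" "g2 < 2 * pi / 3 + \<bar>h j - h k\<bar>" "g3 < 2 * pi / 3 + \<bar>h k - h i\<bar>"
  using assms parallel_swap[of i j g1] parallel_swap[of j k g2] parallel_swap[of k i g3]
  unfolding gap_triple_def by fastforce+

text \<open>Edges \<open>i\<close> and \<open>j\<close> form a fan opposite to \<open>k\<close>.
  Exchanges with \<open>k\<close> by \<open>opt3\<close> supply the four inequalities of
  \<open>fan_impossible\<close>, and \<open>tilted_swap\<close> with \<open>k\<close> excludes its
  two remaining cases.\<close>

lemma narrow_false:
  assumes G: "gap_triple i j k g1 g2 g3" and narrow: "g1 + h i + h j < 2 * pi / 3"
  shows False
proof -
  have K: "i \<in> K" "j \<in> K" "k \<in> K" and ne: "i \<noteq> j" "j \<noteq> k" "k \<noteq> i" "i \<noteq> k"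
    and dir: "same_dir (B j - B i) g1" "same_dir (B k - B j) g2" "same_dir (B i - B k) g3"
    and g: "g1 \<le> pi" "g2 \<le> pi" "g3 \<le> pi" "g1 + g2 + g3 = 2 * pi"
    using G by (auto simp: gap_triple_def)
  note less = gap_triple_less[OF G]
  note hr = h_range[OF K(1)] h_range[OF K(2)] h_range[OF K(3)]
  \<comment> \<open>The bounds on the gaps add up to
    \<open>h i + h j < \<bar>h j - h k\<bar> + \<bar>h k - h i\<bar>\<close>, which forces
    \<open>h k\<close> to be the largest.\<close>
  have hk: "h i + h j < h k" using less g narrow hr by (auto simp: abs_if split: if_splits)
  have g2: "g2 < 2 * pi / 3 + h k - h j" and g3: "g3 < 2 * pi / 3 + h k - h i"
    using less hk hr by auto
  define I where "I = g1 - h i - h j"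
  have I0: "0 \<le> I" using g2 g3 g hr unfolding I_def by auto
  have far: "c0 * (R j b + R k True) \<le> L j b k True" "c0 * (R k False + R i b) \<le> L k False i b" for b
    using g2 g3 g hr narrow L_far[OF K(2,3) dir(2), of True b] L_far[OF K(3,1) dir(3), of b False]
    by (cases b; simp)+
  \<comment> \<open>Endpoint \<open>b\<close> of \<open>i\<close> is joined to endpoint
    \<open>c\<close> of \<open>j\<close>, the other two to the far endpoints of \<open>k\<close>;
    the distances of \<open>k\<close> cancel by \<open>short\<close>.\<close>
  have rest: "L i b j c + c0 * (R j (\<not> c) + R i (\<not> b)) < L i True i False + L j True j False" for b c
    using opt3[OF K ne(1-3), of b c True] far(1)[of "\<not> c"] far(2)[of "\<not> b"] short[OF K(3)]
    unfolding distrib_left by simp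
  have selfs: "L i True i False = D (R i False) (R i True) (2 * h i)"
      "L j True j False = D (R j True) (R j False) (2 * h j)"
    by (simp_all add: L_self D_commute)
  show False
  proof (rule fan_impossible[of "R i False" "R i True" "R j False" "R j True" "h i" "h j" I])
    show "D (R i True) (R j False) I + c0 * (R i False + R j True)
        < D (R i False) (R i True) (2 * h i) + D (R j True) (R j False) (2 * h j)"
      using rest[of True False] unfolding selfs L_gap[OF dir(1)] I_def by (simp add: algebra_simps)
    show "D (R i True) (R j True) (I + 2 * h j) + c0 * (R i False + R j False)
        < D (R i False) (R i True) (2 * h i) + D (R j True) (R j False) (2 * h j)"
      using rest[of True True] unfolding selfs L_gap[OF dir(1)] I_def by (simp add: algebra_simps)
    show "D (R i False) (R j False) (I + 2 * h i) + c0 * (R i True + R j True)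
        < D (R i False) (R i True) (2 * h i) + D (R j True) (R j False) (2 * h j)"
      using rest[of False False] unfolding selfs L_gap[OF dir(1)] I_def by (simp add: algebra_simps)
    show "D (R i False) (R j True) (I + 2 * h i + 2 * h j) + c0 * (R i True + R j False)
        < D (R i False) (R i True) (2 * h i) + D (R j True) (R j False) (2 * h j)"
      using rest[of False True] unfolding selfs L_gap[OF dir(1)] I_def by (simp add: algebra_simps)
    show "D (R i False) (R i True) (2 * h i) < c0 * (R i False + R i True)"
      "D (R j True) (R j False) (2 * h j) < c0 * (R j True + R j False)"
      using short[OF K(1)] short[OF K(2)] unfolding selfs by (simp_all add: add.commute)
  next
    assume good: "R i True \<le> R i False" "I \<le> 2 * h i" "I \<le> 2 * h j"
    \<comment> \<open>The amount by which the narrower new angle \<open>g3 - h k + h i\<close>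
      misses \<open>2 * pi / 3\<close>. It is below \<open>I\<close>, so
      \<open>I \<le> 2 * h i\<close> gives \<open>d \<le> 2 * h i\<close>, and
      \<open>I \<le> 2 * h j\<close> with \<open>narrow\<close> gives
      \<open>d \<le> pi / 3 - h i\<close>.\<close>
    define d where "d = 2 * pi / 3 + h k - h i - g3"
    show False
    proof (rule tilted_swap[of i k False False "g3 + h k - h i" d])
      show "L i False k False = D (R i False) (R k False) (g3 + h k - h i)"
        unfolding L_sym[of i] L_gap[OF dir(3)] by (simp add: D_commute algebra_simps)
      show "L i (\<not> False) k (\<not> False) = D (R i (\<not> False)) (R k (\<not> False)) (2 * pi / 3 - d)"
        unfolding L_sym[of i] L_gap[OF dir(3)] by (simp add: D_commute d_def algebra_simps)
    qed (use K ne good g2 g3 g hr narrow in \<open>auto simp: d_def I_def\<close>)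
  next
    assume good: "R j False \<le> R j True" "I \<le> 2 * h i" "I \<le> 2 * h j"
    define d where "d = 2 * pi / 3 + h k - h j - g2"
    show False
    proof (rule tilted_swap[of j k True True "g2 + h k - h j" d])
      show "L j True k True = D (R j True) (R k True) (g2 + h k - h j)"
        unfolding L_gap[OF dir(2)] by (simp add: algebra_simps)
      show "L j (\<not> True) k (\<not> True) = D (R j (\<not> True)) (R k (\<not> True)) (2 * pi / 3 - d)"
        unfolding L_gap[OF dir(2)] by (simp add: d_def algebra_simps)
    qed (use K ne good g2 g3 g hr narrow in \<open>auto simp: d_def I_def\<close>)
  qed (use K R_pos hr I0 narrow in \<open>auto simp: I_def\<close>)
qed

text \<open>The cyclic rematching joins the \<open>False\<close> endpoint of each edge to the
  \<open>True\<close> endpoint of the next. All three angles are in the range of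
  \<open>D_far\<close>: \<open>wide\<close> bounds them below, \<open>gap_triple_less\<close>
  above.\<close>

lemma wide_false:
  assumes G: "gap_triple i j k g1 g2 g3"
    and wide: "2 * pi / 3 \<le> g1 + h i + h j" "2 * pi / 3 \<le> g2 + h j + h k" "2 * pi / 3 \<le> g3 + h k + h i"
  shows False
proof -
  have K: "i \<in> K" "j \<in> K" "k \<in> K" and ne: "i \<noteq> j" "j \<noteq> k" "k \<noteq> i"
    and dir: "same_dir (B j - B i) g1" "same_dir (B k - B j) g2" "same_dir (B i - B k) g3"
    using G by (auto simp: gap_triple_def)
  note less = gap_triple_less[OF G]
  note hr = h_range[OF K(1)] h_range[OF K(2)] h_range[OF K(3)]
  have "g1 + h i + h j \<le> 4 * pi / 3" "g2 + h j + h k \<le> 4 * pi / 3" "g3 + h k + h i \<le> 4 * pi / 3"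
    using less hr by (auto simp: abs_if split: if_splits)
  then have "c0 * (R i False + R j True) \<le> L i False j True" "c0 * (R j False + R k True) \<le> L j False k True"
    "c0 * (R k False + R i True) \<le> L k False i True"
    using wide L_far[OF K(1,2) dir(1), of True False] L_far[OF K(2,3) dir(2), of True False]
      L_far[OF K(3,1) dir(3), of True False]
    by (simp_all add: add_ac)
  then show False
    using opt3[OF K ne, of False True True] short[OF K(1)] short[OF K(2)] short[OF K(3)]
    unfolding distrib_left by simp
qed

lemma gap_triple_false:
  assumes "gap_triple i j k g1 g2 g3"
  shows False
proof -
  note G = assms assms[THEN gap_triple_rotate] assms[THEN gap_triple_rotate, THEN gap_triple_rotate]
  show False using G[THEN narrow_false] wide_false[OF G(1)] by fastforce
qed

end

section \<open>Local maximality\<close>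

lemma edge_len_pair: "edge_len {a, b} = dist a b"
  unfolding edge_len_def by (rule the_equality) (auto simp: doubleton_eq_iff dist_commute)

lemma perfect_matching_Union:
  assumes "\<And>e. e \<in> E \<Longrightarrow> card e = 2" "\<And>e e'. e \<in> E \<Longrightarrow> e' \<in> E \<Longrightarrow> e \<noteq> e' \<Longrightarrow> e \<inter> e' = {}"
  shows "perfect_matching (\<Union>E) E"
  unfolding perfect_matching_def
proof (intro conjI ballI)
  fix e assume e: "e \<in> E"
  obtain a b where "e = {a, b}" "a \<noteq> b"
    using assms(1)[OF e] unfolding card_2_iff by (elim exE conjE)
  with e show "\<exists>a b. a \<noteq> b \<and> e = {a, b} \<and> a \<in> \<Union>E \<and> b \<in> \<Union>E"
    by (intro exI[of _ a] exI[of _ b]) auto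
next
  fix x assume "x \<in> \<Union>E"
  then show "\<exists>!e. e \<in> E \<and> x \<in> e" using assms(2) by blast
qed

section \<open>Edges of a perfect matching\<close>

context
  fixes P :: "point set" and M :: "point set set"
  assumes M: "perfect_matching P M"
begin

lemma matching_edge:
  assumes "e \<in> M"
  obtains a b where "a \<noteq> b" "e = {a, b}" "a \<in> P" "b \<in> P"
proof -
  have "\<forall>e\<in>M. \<exists>a b. a \<noteq> b \<and> e = {a, b} \<and> a \<in> P \<and> b \<in> P"
    using M unfolding perfect_matching_def by (rule conjunct1)
  from bspec[OF this assms] show thesis by (elim exE conjE) (rule that)
qed

lemma matching_unique: "x \<in> P \<Longrightarrow> \<exists>!e. e \<in> M \<and> x \<in> e"
  using M[unfolded perfect_matching_def, THEN conjunct2] by (rule bspec)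

lemma matching_Union: "\<Union>M = P"
proof
  show "\<Union>M \<subseteq> P" by (auto elim: matching_edge)
  show "P \<subseteq> \<Union>M" using matching_unique by blast
qed

lemma matching_disjoint:
  assumes "e \<in> M" "e' \<in> M" "e \<noteq> e'"
  shows "e \<inter> e' = {}"
proof (rule ccontr)
  assume "e \<inter> e' \<noteq> {}"
  then obtain x where x: "x \<in> e" "x \<in> e'" by blast
  then have "x \<in> P" using assms(1) matching_Union by blast
  from matching_unique[OF this] show False using x assms by blast
qed

lemma matching_neq:
  assumes "{a, b} \<in> M" shows "a \<noteq> b"
proof
  assume "a = b"
  then have "card {a, b} = 1" by simp
  moreover obtain c d where "c \<noteq> d" "{a, b} = {c, d}"
    using assms by (rule matching_edge)
  ultimately show False by simp
qed

text \<open>Makes the sum of the distances to a fixed centre independent of the matching.\<close>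

lemma matching_sum: "(\<Sum>e\<in>M. sum g e) = sum g P"
proof -
  have "\<forall>e\<in>M. finite e" by (auto elim: matching_edge)
  moreover have "\<forall>e\<in>M. \<forall>e'\<in>M. e \<noteq> e' \<longrightarrow> e \<inter> e' = {}" using matching_disjoint by blast
  ultimately have "sum g (\<Union>M) = (\<Sum>e\<in>M. sum g e)"
    using sum.Union_disjoint[of M g] by simp
  then show ?thesis unfolding matching_Union by simp
qed

end

section \<open>Exchange inequalities for two and three edges\<close>

lemma local_max_le:
  assumes "local_max k P M" "N \<subseteq> M" "card N \<le> k" "perfect_matching (\<Union>N) N'"
  shows "w N' \<le> w N"
  using assms unfolding local_max_def max_matching_def by blast

lemma local_max_pair:
  assumes loc: "local_max 3 P M" and e: "{x1, y1} \<in> M" "{x2, y2} \<in> M" "{x1, y1} \<noteq> {x2, y2}"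
  shows "dist x1 x2 + dist y1 y2 \<le> dist x1 y1 + dist x2 y2"
proof -
  let ?N = "{{x1, y1}, {x2, y2}}" and ?N' = "{{x1, x2}, {y1, y2}}"
  have M: "perfect_matching P M" using loc by (simp add: local_max_def)
  have ne: "x1 \<noteq> y1" "x2 \<noteq> y2" using matching_neq[OF M e(1)] matching_neq[OF M e(2)] .
  have "{x1, y1} \<inter> {x2, y2} = {}" using matching_disjoint[OF M e] .
  then have ds: "x1 \<noteq> x2" "x1 \<noteq> y2" "y1 \<noteq> x2" "y1 \<noteq> y2" by blast+
  have un: "\<Union>?N = \<Union>?N'" by auto
  have pm: "perfect_matching (\<Union>?N) ?N'"
    unfolding un
  proof (rule perfect_matching_Union)
    fix e assume "e \<in> ?N'"
    then show "card e = 2" using ds by (elim insertE emptyE) simp_all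
  next
    fix e e' assume "e \<in> ?N'" "e' \<in> ?N'" "e \<noteq> e'"
    then show "e \<inter> e' = {}" using ds ne by (elim insertE emptyE) simp_all
  qed
  have "w ?N' \<le> w ?N"
    using e by (intro local_max_le[OF loc _ _ pm]) (simp_all add: card_insert_if)
  moreover have "w ?N = dist x1 y1 + dist x2 y2" using e(3) by (simp add: w_def edge_len_pair)
  moreover have "{x1, x2} \<noteq> {y1, y2}" using ds ne by (simp add: doubleton_eq_iff)
  then have "w ?N' = dist x1 x2 + dist y1 y2" by (simp add: w_def edge_len_pair)
  ultimately show ?thesis by simp
qed

text \<open>An exchange along an alternating hexagon. The eight ways to label the endpoints of the
  three edges give all rematchings that keep none of them.\<close>

lemma local_max_triple:
  assumes loc: "local_max 3 P M"
    and e: "{x1, y1} \<in> M" "{x2, y2} \<in> M" "{x3, y3} \<in> M"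
    and neq: "{x1, y1} \<noteq> {x2, y2}" "{x2, y2} \<noteq> {x3, y3}" "{x3, y3} \<noteq> {x1, y1}"
  shows "dist x1 x2 + dist y2 x3 + dist y3 y1 \<le> dist x1 y1 + dist x2 y2 + dist x3 y3"
proof -
  let ?N = "{{x1, y1}, {x2, y2}, {x3, y3}}" and ?N' = "{{x1, x2}, {y2, x3}, {y3, y1}}"
  have M: "perfect_matching P M" using loc by (simp add: local_max_def)
  have ne: "x1 \<noteq> y1" "x2 \<noteq> y2" "x3 \<noteq> y3"
    using matching_neq[OF M e(1)] matching_neq[OF M e(2)] matching_neq[OF M e(3)] .
  have "{x1, y1} \<inter> {x2, y2} = {}" "{x2, y2} \<inter> {x3, y3} = {}" "{x3, y3} \<inter> {x1, y1} = {}"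
    using matching_disjoint[OF M e(1,2) neq(1)] matching_disjoint[OF M e(2,3) neq(2)]
      matching_disjoint[OF M e(3,1) neq(3)] .
  then have ds: "x1 \<noteq> x2" "x1 \<noteq> y2" "y1 \<noteq> x2" "y1 \<noteq> y2" "x2 \<noteq> x3" "x2 \<noteq> y3" "y2 \<noteq> x3" "y2 \<noteq> y3"
    "x3 \<noteq> x1" "x3 \<noteq> y1" "y3 \<noteq> x1" "y3 \<noteq> y1" by blast+
  have un: "\<Union>?N = \<Union>?N'" by auto
  have pm: "perfect_matching (\<Union>?N) ?N'"
    unfolding un
  proof (rule perfect_matching_Union)
    fix e assume "e \<in> ?N'"
    then show "card e = 2" using ds by (elim insertE emptyE) simp_all
  next
    fix e e' assume "e \<in> ?N'" "e' \<in> ?N'" "e \<noteq> e'"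
    then show "e \<inter> e' = {}" using ds ne by (elim insertE emptyE) simp_all
  qed
  have "w ?N' \<le> w ?N"
    using e by (intro local_max_le[OF loc _ _ pm]) (simp_all add: card_insert_if)
  moreover have "w ?N = dist x1 y1 + dist x2 y2 + dist x3 y3"
    using neq by (simp add: w_def edge_len_pair)
  moreover have "{x1, x2} \<noteq> {y2, x3}" "{y2, x3} \<noteq> {y3, y1}" "{x1, x2} \<noteq> {y3, y1}"
    using ds ne by (simp_all add: doubleton_eq_iff)
  then have "w ?N' = dist x1 x2 + dist y2 x3 + dist y3 y1" by (simp add: w_def edge_len_pair)
  ultimately show ?thesis by simp
qed

section \<open>The centre\<close>

definition pol :: "real \<Rightarrow> real \<Rightarrow> point" where
  "pol r t = vector [r * cos t, r * sin t]"

lemma pol_nth [simp]: "pol r t $ 1 = r * cos t" "pol r t $ 2 = r * sin t"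
  by (simp_all add: pol_def vector_2)

lemma pol_eqI: "x $ 1 = r * cos t \<Longrightarrow> x $ 2 = r * sin t \<Longrightarrow> x = pol r t"
  by (simp add: vec_eq_iff forall_2)

lemma dist_pol: "dist (z + pol r x) (z + pol s y) = D r s (y - x)"
proof -
  have "dist (z + pol r x) (z + pol s y) = sqrt ((r * cos x - s * cos y)\<^sup>2 + (r * sin x - s * sin y)\<^sup>2)"
    by (simp add: dist_vec_def L2_set_def sum_2 dist_real_def)
  then show ?thesis unfolding D_def D_arg[of r s "y - x" x] by simp
qed

lemma norm_pol: "norm (pol r t) = \<bar>r\<bar>"
  using dist_pol[of 0 r t 0 t] by (simp add: D_def pol_eqI[of 0 0 t, symmetric])

lemma pol_ex:
  assumes "v \<noteq> 0" obtains r t where "0 < r" "v = pol r t"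
proof -
  have sq: "(norm v)\<^sup>2 = (v $ 1)\<^sup>2 + (v $ 2)\<^sup>2"
    by (simp add: norm_vec_def L2_set_def sum_2)
  have "(v $ 1 / norm v)\<^sup>2 + (v $ 2 / norm v)\<^sup>2 = ((v $ 1)\<^sup>2 + (v $ 2)\<^sup>2) / (norm v)\<^sup>2"
    by (simp add: power_divide add_divide_distrib)
  also have "\<dots> = 1" unfolding sq[symmetric] using assms by simp
  finally obtain t where "v $ 1 / norm v = cos t" "v $ 2 / norm v = sin t"
    using sincos_total_2pi by metis
  then have "v = pol (norm v) t" using assms by (intro pol_eqI) (auto simp: field_simps)
  then show thesis using that[of "norm v" t] assms by simp
qed

lemma same_dir_pol: assumes "same_dir x y" shows "pol r (z - x) = pol r (z - y)"
proof -
  have "cos (z - x) = cos (z - y)" "sin (z - x) = sin (z - y)"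
    using assms unfolding cos_diff sin_diff same_dir_def by (metis)+
  then show ?thesis by (simp add: pol_def)
qed

lemma same_dir_ex:
  assumes "0 \<le> sin x" obtains g where "0 \<le> g" "g \<le> pi" "same_dir x g"
proof -
  have "sin (arccos (cos x)) = sqrt (1 - (cos x)\<^sup>2)" by (rule sin_arccos) auto
  also have "\<dots> = sin x"
    using assms by (intro real_sqrt_unique sin_squared_eq)
  finally have "same_dir x (arccos (cos x))" by (simp add: same_dir_def)
  then show thesis by (intro that[of "arccos (cos x)"] arccos_lbound arccos_ubound) auto
qed

lemma sgn_pol: "0 < r \<Longrightarrow> sgn (pol r t) = pol 1 t"
  unfolding sgn_div_norm norm_pol by (simp add: vec_eq_iff forall_2)

text \<open>By \<open>D_far\<close> a short edge is seen under an angle below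
  \<open>2 * pi / 3\<close>. With \<open>x\<close> its bisector and \<open>h\<close> half of it, the
  unit vectors to the endpoints add up to a multiple of the bisector; the endpoints are ordered so
  that the first is counterclockwise.\<close>

lemma edge_polar:
  fixes a b z :: point
  assumes "a \<noteq> z" "b \<noteq> z" and short: "dist a b < c0 * (dist a z + dist b z)"
  obtains (polar) r s x h where "{a, b} = {z + pol r (x + h), z + pol s (x - h)}"
    "0 < r" "0 < s" "0 \<le> h" "h < pi / 3" "sgn (a - z) + sgn (b - z) = (2 * cos h) *\<^sub>R pol 1 x"
proof -
  obtain r x where a: "0 < r" "a - z = pol r x" using pol_ex[of "a - z"] assms(1) by auto
  obtain s y where b: "0 < s" "b - z = pol s y" using pol_ex[of "b - z"] assms(2) by auto
  have *: thesis
    if asm: "0 \<le> sin (x - y)" "0 < r" "0 < s" "{a, b} = {z + pol r x, z + pol s y}"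
      "sgn (a - z) + sgn (b - z) = sgn (pol r x) + sgn (pol s y)"
      "dist (z + pol r x) (z + pol s y) < c0 * (r + s)" for r s x y
  proof -
    obtain g where g: "0 \<le> g" "g \<le> pi" "same_dir (x - y) g" by (rule same_dir_ex[OF asm(1)])
    have y: "pol t y = pol t (x - g)" for t using same_dir_pol[OF g(3), of t x] by simp
    have eqs: "x - g / 2 + g / 2 = x" "x - g / 2 - g / 2 = x - g" by simp_all
    have "D r s g < c0 * (r + s)" using asm(6) unfolding y dist_pol by simp
    moreover have "c0 * (r + s) \<le> D r s g" if "2 * pi / 3 \<le> g"
      using asm(2,3) g(2) that pi_ge_zero by (intro D_far) linarith+
    ultimately have "g < 2 * pi / 3" by (meson not_less)
    then have small: "g / 2 < pi / 3" by simp
    have half: "pol 1 x + pol 1 (x - g) = (2 * cos (g / 2)) *\<^sub>R pol 1 (x - g / 2)"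
    proof -
      have "cos x + cos (x - g) = 2 * cos (g / 2) * cos (x - g / 2)"
        "sin x + sin (x - g) = 2 * cos (g / 2) * sin (x - g / 2)"
        using cos_add[of "x - g / 2" "g / 2"] cos_diff[of "x - g / 2" "g / 2"]
          sin_add[of "x - g / 2" "g / 2"] sin_diff[of "x - g / 2" "g / 2"]
        unfolding eqs by simp_all
      then show ?thesis by (simp add: vec_eq_iff forall_2)
    qed
    have sgn: "sgn (a - z) + sgn (b - z) = (2 * cos (g / 2)) *\<^sub>R pol 1 (x - g / 2)"
      using asm(5) half unfolding y sgn_pol[OF asm(2)] sgn_pol[OF asm(3)] by (rule trans)
    have ends: "{a, b} = {z + pol r (x - g / 2 + g / 2), z + pol s (x - g / 2 - g / 2)}"
      unfolding eqs using asm(4) unfolding y .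
    have "0 \<le> g / 2" using g(1) by simp
    from polar[OF ends asm(2,3) this small sgn] show thesis .
  qed
  have d: "dist a z = r" "dist b z = s"
    unfolding dist_norm a(2) b(2) norm_pol using a(1) b(1) by simp_all
  have ab: "a = z + pol r x" "b = z + pol s y"
    unfolding a(2)[symmetric] b(2)[symmetric] by simp_all
  have sg: "sgn (a - z) + sgn (b - z) = sgn (pol r x) + sgn (pol s y)"
    unfolding a(2) b(2) ..
  have sh: "dist (z + pol r x) (z + pol s y) < c0 * (r + s)" using short unfolding d ab[symmetric] .
  have pts: "{a, b} = {z + pol r x, z + pol s y}" using ab by (rule arg_cong2)
  have pts': "{a, b} = {z + pol s y, z + pol r x}" using pts by (simp only: insert_commute)
  have sg': "sgn (a - z) + sgn (b - z) = sgn (pol s y) + sgn (pol r x)"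
    using sg by (simp only: add.commute)
  have sh': "dist (z + pol s y) (z + pol r x) < c0 * (s + r)"
    by (subst dist_commute, subst add.commute, rule sh)
  show thesis
  proof (cases "0 \<le> sin (x - y)")
    case True
    from *[OF True a(1) b(1) pts sg sh] show ?thesis .
  next
    case False
    then have "0 \<le> sin (y - x)" using sin_minus[of "x - y"] by simp
    from *[OF this b(1) a(1) pts' sg' sh'] show ?thesis .
  qed
qed

section \<open>Minima of a maximum of finitely many functions\<close>

lemma continuous_on_Max_image:
  fixes f :: "'e \<Rightarrow> 'a::topological_space \<Rightarrow> real"
  assumes "finite E" "E \<noteq> {}" "\<And>e. e \<in> E \<Longrightarrow> continuous_on S (f e)"
  shows "continuous_on S (\<lambda>x. Max ((\<lambda>e. f e x) ` E))"
  using assms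
proof (induction rule: finite_ne_induct)
  case (insert e E)
  then show ?case by (simp add: continuous_on_max)
qed simp

text \<open>Otherwise a hyperplane separates \<open>0\<close> from the active gradients. A small
  step from \<open>z\<close> against its normal \<open>v\<close> strictly decreases every active
  function and, by continuity, keeps the others below the maximum, contradicting minimality.\<close>

lemma minimax_critical:
  fixes f :: "'e \<Rightarrow> 'a::euclidean_space \<Rightarrow> real"
  assumes E: "finite E" "E \<noteq> {}" and cont: "\<And>e. e \<in> E \<Longrightarrow> isCont (f e) z"
    and min: "\<And>x. Max ((\<lambda>e. f e z) ` E) \<le> Max ((\<lambda>e. f e x) ` E)"
    and deriv: "\<And>e. \<lbrakk>e \<in> E; f e z = Max ((\<lambda>e. f e z) ` E)\<rbrakk> \<Longrightarrow> (f e has_derivative (\<lambda>v. u e \<bullet> v)) (at z)"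
  shows "0 \<in> convex hull (u ` {e \<in> E. f e z = Max ((\<lambda>e. f e z) ` E)})"
proof (rule ccontr)
  let ?m = "Max ((\<lambda>e. f e z) ` E)"
  let ?A = "{e \<in> E. f e z = ?m}"
  assume "0 \<notin> convex hull (u ` ?A)"
  moreover have "closed (convex hull (u ` ?A))"
    using E by (intro compact_imp_closed finite_imp_compact_convex_hull) auto
  ultimately obtain v b where v: "0 < b" "\<And>x. x \<in> convex hull (u ` ?A) \<Longrightarrow> b < v \<bullet> x"
    using separating_hyperplane_closed_0[of "convex hull (u ` ?A)"] by auto
  have "\<forall>\<^sub>F t in at_right 0. f e (z - t *\<^sub>R v) < ?m" if e: "e \<in> E" for e
  proof (cases "f e z = ?m")
    case True
    have "((\<lambda>t. z - t *\<^sub>R v) has_derivative (\<lambda>t. - (t *\<^sub>R v))) (at 0)"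
      by (auto intro!: derivative_eq_intros)
    moreover have "(f e has_derivative (\<lambda>v. u e \<bullet> v)) (at (z - 0 *\<^sub>R v))"
      using deriv[OF e True] by simp
    ultimately have "((\<lambda>t. f e (z - t *\<^sub>R v)) has_derivative (\<lambda>t. u e \<bullet> - (t *\<^sub>R v))) (at 0)"
      by (rule has_derivative_compose)
    moreover have "(\<lambda>t. u e \<bullet> - (t *\<^sub>R v)) = (*) (- (u e \<bullet> v))"
      by (auto simp: fun_eq_iff)
    ultimately have "((\<lambda>t. f e (z - t *\<^sub>R v)) has_real_derivative - (u e \<bullet> v)) (at 0)"
      by (simp only: has_field_derivative_def)
    moreover have "b < v \<bullet> u e" using e True by (intro v(2) hull_inc) auto
    then have "- (u e \<bullet> v) < 0" using v(1) by (simp add: inner_commute)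
    ultimately obtain d where "0 < d" "\<And>t. 0 < t \<Longrightarrow> t < d \<Longrightarrow> f e (z - t *\<^sub>R v) < f e z"
      using DERIV_neg_dec_right by fastforce
    then show ?thesis using True unfolding eventually_at_right_field by auto
  next
    case False
    then have "f e z < ?m" using E e by (simp add: order_less_le)
    moreover have "((\<lambda>t. f e (z - t *\<^sub>R v)) \<longlongrightarrow> f e (z - 0 *\<^sub>R v)) (at_right 0)"
      using cont[OF e] by (intro isCont_tendsto_compose[of _ "f e"] tendsto_intros) auto
    ultimately show ?thesis by (intro order_tendstoD) auto
  qed
  then have "\<forall>\<^sub>F t in at_right 0. \<forall>e\<in>E. f e (z - t *\<^sub>R v) < ?m"
    using E by (intro eventually_ball_finite) auto
  then obtain t where "\<forall>e\<in>E. f e (z - t *\<^sub>R v) < ?m"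
    using eventually_happens'[OF trivial_limit_at_right_real] by blast
  then have "Max ((\<lambda>e. f e (z - t *\<^sub>R v)) ` E) < ?m" using E by simp
  then show False using min[of "z - t *\<^sub>R v"] by simp
qed

text \<open>Cross products of the relation with the directions \<open>x1\<close> and
  \<open>x2\<close> show that the three sines of consecutive differences have equal sign, so all
  gaps can be taken in \<open>[0, pi]\<close>. Their sum is a multiple of \<open>2 * pi\<close>
  below \<open>4 * pi\<close>; sum \<open>0\<close> would make all directions equal, which positive
  weights exclude.\<close>

lemma gaps_ordered:
  assumes t: "0 < t1" "0 < t2" "0 < t3"
    and s: "t1 * sin x1 + t2 * sin x2 + t3 * sin x3 = 0" and c: "t1 * cos x1 + t2 * cos x2 + t3 * cos x3 = 0"
    and ord: "0 \<le> sin (x2 - x1)"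
  obtains g1 g2 g3 where "same_dir (x2 - x1) g1" "same_dir (x3 - x2) g2" "same_dir (x1 - x3) g3"
    "g1 \<le> pi" "g2 \<le> pi" "g3 \<le> pi" "g1 + g2 + g3 = 2 * pi"
proof -
  have rel: "t2 * sin (x2 - x1) = t3 * sin (x1 - x3)" "t3 * sin (x3 - x2) = t1 * sin (x2 - x1)"
    "t1 + t2 * cos (x2 - x1) + t3 * cos (x1 - x3) = 0"
  proof -
    have "t2 * sin (x2 - x1) - t3 * sin (x1 - x3)
        = cos x1 * (t1 * sin x1 + t2 * sin x2 + t3 * sin x3) - sin x1 * (t1 * cos x1 + t2 * cos x2 + t3 * cos x3)"
      by (simp add: sin_diff algebra_simps)
    then show "t2 * sin (x2 - x1) = t3 * sin (x1 - x3)" unfolding s c by simp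
    have "t3 * sin (x3 - x2) - t1 * sin (x2 - x1)
        = cos x2 * (t1 * sin x1 + t2 * sin x2 + t3 * sin x3) - sin x2 * (t1 * cos x1 + t2 * cos x2 + t3 * cos x3)"
      by (simp add: sin_diff algebra_simps)
    then show "t3 * sin (x3 - x2) = t1 * sin (x2 - x1)" unfolding s c by simp
    have "t1 * ((sin x1)\<^sup>2 + (cos x1)\<^sup>2) + t2 * cos (x2 - x1) + t3 * cos (x1 - x3)
        = sin x1 * (t1 * sin x1 + t2 * sin x2 + t3 * sin x3) + cos x1 * (t1 * cos x1 + t2 * cos x2 + t3 * cos x3)"
      by (simp only: cos_diff power2_eq_square ring_distribs mult_ac add_ac)
    then show "t1 + t2 * cos (x2 - x1) + t3 * cos (x1 - x3) = 0" unfolding s c by simp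
  qed
  have "0 \<le> t3 * sin (x1 - x3)" "0 \<le> t3 * sin (x3 - x2)"
    unfolding rel(1)[symmetric] rel(2) using t ord by simp_all
  then have ord': "0 \<le> sin (x1 - x3)" "0 \<le> sin (x3 - x2)" using t by (simp_all add: zero_le_mult_iff)
  obtain g1 where g1: "0 \<le> g1" "g1 \<le> pi" "same_dir (x2 - x1) g1" by (rule same_dir_ex[OF ord])
  obtain g2 where g2: "0 \<le> g2" "g2 \<le> pi" "same_dir (x3 - x2) g2" by (rule same_dir_ex[OF ord'(2)])
  obtain g3 where g3: "0 \<le> g3" "g3 \<le> pi" "same_dir (x1 - x3) g3" by (rule same_dir_ex[OF ord'(1)])
  have trig: "sin (x2 - x1) = sin g1" "cos (x2 - x1) = cos g1" "sin (x3 - x2) = sin g2" "cos (x3 - x2) = cos g2"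
    "sin (x1 - x3) = sin g3" "cos (x1 - x3) = cos g3"
    using g1(3) g2(3) g3(3) by (simp_all only: same_dir_def)
  have "cos (g1 + g2 + g3) = cos ((x2 - x1) + (x3 - x2) + (x1 - x3))"
    unfolding cos_add sin_add trig ..
  then have "cos (g1 + g2 + g3) = 1" by simp
  then obtain n :: int where n: "g1 + g2 + g3 = real_of_int n * (2 * pi)"
    unfolding cos_one_2pi_int mult.assoc by (elim exE)
  have "g1 + g2 + g3 \<noteq> 0"
  proof
    assume "g1 + g2 + g3 = 0"
    then have "g1 = 0" "g3 = 0" using g1(1) g2(1) g3(1) by linarith+
    then have "cos g1 = 1" "cos g3 = 1" by simp_all
    then have "t1 + t2 + t3 = 0" using rel(3) unfolding trig by simp
    then show False using t by linarith
  qed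
  then have "0 < g1 + g2 + g3" "g1 + g2 + g3 < 2 * (2 * pi)"
    using g1(1,2) g2(1,2) g3(1,2) pi_gt_zero by linarith+
  then have "0 < real_of_int n * (2 * pi)" "real_of_int n * (2 * pi) < 2 * (2 * pi)"
    unfolding n .
  then have "0 < real_of_int n" "real_of_int n < 2"
    using zero_less_mult_pos2[of "real_of_int n" "2 * pi"] mult_right_less_imp_less[of "real_of_int n" "2 * pi" 2] pi_gt_zero
    by linarith+
  then have "n = 1" by linarith
  then have "g1 + g2 + g3 = 2 * pi" using n by simp
  with g1(3) g2(3) g3(3) g1(2) g2(2) g3(2) show thesis by (rule that)
qed

context star
begin

text \<open>A single direction cannot be balanced. Two are opposite and fall to
  \<open>parallel_swap\<close> with gap \<open>pi\<close>. Three form a \<open>gap_triple\<close> in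
  the order given by the sign of \<open>sin (B j - B i)\<close>.\<close>

lemma balanced_false:
  assumes A: "finite T" "T \<noteq> {}" "card T \<le> 3" "inj_on g T" "g ` T \<subseteq> K"
    and t: "\<And>v. v \<in> T \<Longrightarrow> 0 < t v"
    and s: "(\<Sum>v\<in>T. t v * sin (B (g v))) = 0" and c: "(\<Sum>v\<in>T. t v * cos (B (g v))) = 0"
  shows False
proof -
  have "card T \<noteq> 0" using A by auto
  then consider "card T = 1" | "card T = 2" | "card T = 3" using A by linarith
  then show False
  proof cases
    case 1
    then obtain x where "T = {x}" using card_1_singletonE by blast
    then have "sin (B (g x)) = 0" "cos (B (g x)) = 0" using s c t by force+
    then show False using sin_zero_abs_cos_one by fastforce
  next
    case 2
    then obtain x y where T: "T = {x, y}" "x \<noteq> y" by (auto simp: card_2_iff)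
    define i j where "i = g x" and "j = g y"
    have K: "i \<in> K" "j \<in> K" "i \<noteq> j" using A T by (auto simp: i_def j_def inj_on_def)
    have t2: "0 < t x" "0 < t y" using t T by auto
    have s2: "t x * sin (B i) + t y * sin (B j) = 0" and c2: "t x * cos (B i) + t y * cos (B j) = 0"
      using s c T by (simp_all add: i_def j_def)
    have "t y * sin (B j - B i) = cos (B i) * (t x * sin (B i) + t y * sin (B j)) - sin (B i) * (t x * cos (B i) + t y * cos (B j))"
      by (simp add: sin_diff algebra_simps)
    then have sin0: "sin (B j - B i) = 0" unfolding s2 c2 using t2 by simp
    have "t x * ((sin (B i))\<^sup>2 + (cos (B i))\<^sup>2) + t y * cos (B j - B i)
        = sin (B i) * (t x * sin (B i) + t y * sin (B j)) + cos (B i) * (t x * cos (B i) + t y * cos (B j))"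
      by (simp only: cos_diff power2_eq_square ring_distribs mult_ac add_ac)
    then have "t x + t y * cos (B j - B i) = 0" unfolding s2 c2 by simp
    then have "cos (B j - B i) \<noteq> 1" using t2 by auto
    then have "cos (B j - B i) = - 1" using sin_zero_abs_cos_one[OF sin0] by (auto simp: abs_if split: if_splits)
    then have "same_dir (B j - B i) pi" using sin0 by (simp add: same_dir_def)
    moreover have "\<bar>h i - h j\<bar> \<le> pi / 3"
      using h_range[OF K(1)] h_range[OF K(2)] unfolding abs_le_iff by linarith
    ultimately show False using parallel_swap[OF K] by force
  next
    case 3
    then obtain x y z where T: "T = {x, y, z}" "x \<noteq> y" "y \<noteq> z" "x \<noteq> z" by (auto simp: card_3_iff)
    define i j k where "i = g x" and "j = g y" and "k = g z"
    have K: "i \<in> K" "j \<in> K" "k \<in> K" "i \<noteq> j" "j \<noteq> k" "k \<noteq> i"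
      using A T by (auto simp: i_def j_def k_def inj_on_def)
    have t3: "0 < t x" "0 < t y" "0 < t z" using t T by auto
    have s3: "t x * sin (B i) + t y * sin (B j) + t z * sin (B k) = 0"
      and c3: "t x * cos (B i) + t y * cos (B j) + t z * cos (B k) = 0"
      using s c T by (simp_all add: i_def j_def k_def add_ac)
    show False
    proof (cases "0 \<le> sin (B j - B i)")
      case True
      then show False
        using gaps_ordered[OF t3 s3 c3] gap_triple_false[of i j k] K unfolding gap_triple_def by metis
    next
      case False
      then have "0 \<le> sin (B i - B j)" using sin_minus[of "B j - B i"] by simp
      then show False
        using gaps_ordered[OF t3(2,1,3), of "B j" "B i" "B k"] s3 c3 gap_triple_false[of j i k] K
        unfolding gap_triple_def by (metis add.commute)
    qed
  qed
qed

end

section \<open>Existence of the centre\<close>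

lemma has_derivative_dist:
  fixes a z :: "'a::real_inner"
  assumes "a \<noteq> z"
  shows "((\<lambda>x. dist a x) has_derivative (\<lambda>v. - sgn (a - z) \<bullet> v)) (at z)"
proof -
  have "((\<lambda>x. a - x) has_derivative (\<lambda>v. - v)) (at z)"
    by (auto intro!: derivative_eq_intros)
  moreover have "(norm has_derivative (\<lambda>v. v \<bullet> sgn (a - z))) (at (a - z))"
    using assms by (intro has_derivative_norm) simp
  ultimately have "((\<lambda>x. norm (a - x)) has_derivative (\<lambda>v. - v \<bullet> sgn (a - z))) (at z)"
    by (rule has_derivative_compose)
  then show ?thesis by (simp add: dist_norm inner_commute)
qed

lemma exists_center:
  fixes P :: "point set"
  assumes fin: "finite P" and loc: "local_max 3 P M"
  shows "\<exists>z. \<forall>e\<in>M. c0 * (\<Sum>x\<in>e. dist x z) \<le> edge_len e"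
proof (cases "M = {}")
  case False
  have M: "perfect_matching P M" using loc by (simp add: local_max_def)
  have "M \<subseteq> Pow P" using matching_Union[OF M] by blast
  then have finM: "finite M" using fin finite_subset by blast
  \<comment> \<open>Orders the endpoints of every edge, so that the excess \<open>f\<close> can be
    written as a formula.\<close>
  have "\<forall>e\<in>M. \<exists>p. fst p \<noteq> snd p \<and> e = {fst p, snd p}"
  proof
    fix e assume "e \<in> M"
    then obtain a b where "a \<noteq> b" "e = {a, b}" by (rule matching_edge[OF M])
    then show "\<exists>p. fst p \<noteq> snd p \<and> e = {fst p, snd p}" by (intro exI[of _ "(a, b)"]) simp
  qed
  from bchoice[OF this] obtain q where q: "\<forall>e\<in>M. fst (q e) \<noteq> snd (q e) \<and> e = {fst (q e), snd (q e)}"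
    by (elim exE)
  define a b where "a e = fst (q e)" and "b e = snd (q e)" for e
  have ab: "a e \<noteq> b e" "e = {a e, b e}" if "e \<in> M" for e
    unfolding a_def b_def by (rule bspec[OF q that, THEN conjunct1], rule bspec[OF q that, THEN conjunct2])
  define f where "f e x = c0 * (dist (a e) x + dist (b e) x) - dist (a e) (b e)" for e x
  define F where "F x = Max ((\<lambda>e. f e x) ` M)" for x
  have F_ge: "f e x \<le> F x" if "e \<in> M" for e x
    unfolding F_def using finM that by simp
  have cont: "continuous_on S (f e)" for e S
    unfolding f_def by (intro continuous_intros)
  have contF: "continuous_on S F" for S
    unfolding F_def using finM False cont by (rule continuous_on_Max_image)
  obtain z where z: "\<And>x. F z \<le> F x"
  proof -
    obtain e where e: "e \<in> M" using False by blast
    \<comment> \<open>Outside this ball around \<open>a e\<close> the excess of \<open>e\<close>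
      alone is at least \<open>\<bar>F (a e)\<bar>\<close>, so a minimum on the ball is
      global.\<close>
    define r where "r = (\<bar>F (a e)\<bar> + dist (a e) (b e)) / c0"
    have "0 \<le> r" by (simp add: r_def)
    obtain z where z: "z \<in> cball (a e) r" "\<And>x. x \<in> cball (a e) r \<Longrightarrow> F z \<le> F x"
      using continuous_attains_inf[OF compact_cball _ contF, of "a e" r] \<open>0 \<le> r\<close> by auto
    have "F z \<le> F x" if "x \<notin> cball (a e) r" for x
    proof -
      have "F z \<le> F (a e)" using z(2) \<open>0 \<le> r\<close> by simp
      also have "\<dots> \<le> c0 * r - dist (a e) (b e)"
      proof -
        have "c0 * r = \<bar>F (a e)\<bar> + dist (a e) (b e)" by (simp add: r_def)
        then show ?thesis by linarith
      qed
      also have "\<dots> \<le> f e x"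
        using that unfolding f_def by (intro diff_right_mono mult_left_mono) (auto intro: add_increasing2)
      also have "\<dots> \<le> F x" using e by (rule F_ge)
      finally show ?thesis .
    qed
    then show thesis using z(2) by (intro that[of z]) blast
  qed
  have "F z \<le> 0"
  proof (rule ccontr)
    assume pos: "\<not> F z \<le> 0"
    define K where "K = {e \<in> M. f e z = F z}"
    have short: "dist (a e) (b e) < c0 * (dist (a e) z + dist (b e) z)" if "e \<in> K" for e
      using that pos by (simp add: K_def f_def)
    have c0_lt: "c0 < 1"
      using real_sqrt_less_mono[of 3 4] by simp
    \<comment> \<open>At an endpoint the positive excess would read
      \<open>dist (a e) (b e) < c0 * dist (a e) (b e)\<close>; hence the distances are
      differentiable at \<open>z\<close>.\<close>
    have off: "a e \<noteq> z" "b e \<noteq> z" if "e \<in> K" for e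
    proof -
      have *: "c0 * d \<le> d" if "0 \<le> d" for d :: real
        using c0_lt that mult_right_mono[of c0 1 d] by simp
      show "a e \<noteq> z" "b e \<noteq> z"
        using short[OF that] *[of "dist (a e) (b e)", OF zero_le_dist] by (auto simp: dist_commute)
    qed
    have "\<forall>e\<in>K. \<exists>p. case p of (r, s, x, h) \<Rightarrow> e = {z + pol r (x + h), z + pol s (x - h)} \<and> 0 < r \<and> 0 < s \<and>
        0 \<le> h \<and> h < pi / 3 \<and> sgn (a e - z) + sgn (b e - z) = (2 * cos h) *\<^sub>R pol 1 x" (is "\<forall>e\<in>K. \<exists>p. ?W e p")
    proof
      fix e assume e: "e \<in> K"
      obtain r s x h where "{a e, b e} = {z + pol r (x + h), z + pol s (x - h)}" "0 < r" "0 < s"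
        "0 \<le> h" "h < pi / 3" "sgn (a e - z) + sgn (b e - z) = (2 * cos h) *\<^sub>R pol 1 x"
        by (rule edge_polar[OF off(1)[OF e] off(2)[OF e] short[OF e]])
      moreover have "e = {a e, b e}" using e ab by (simp add: K_def)
      ultimately have "?W e (r, s, x, h)" by simp
      then show "\<exists>p. ?W e p" by (rule exI)
    qed
    from bchoice[OF this] obtain p where p: "\<forall>e\<in>K. ?W e (p e)" by blast
    define r s B h where "r e = fst (p e)" and "s e = fst (snd (p e))" and "B e = fst (snd (snd (p e)))"
      and "h e = snd (snd (snd (p e)))" for e
    have XY: "e = {z + pol (r e) (B e + h e), z + pol (s e) (B e - h e)}"
      and rs: "0 < r e" "0 < s e" and h: "0 \<le> h e" "h e < pi / 3"
      and sgn: "sgn (a e - z) + sgn (b e - z) = (2 * cos (h e)) *\<^sub>R pol 1 (B e)" if "e \<in> K" for e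
      using bspec[OF p that] unfolding r_def s_def B_def h_def case_prod_beta by simp_all
    define R where "R e c = (if c then r e else s e)" for e c
    define Q where "Q e c = z + pol (R e c) (B e + side c (h e))" for e c
    have KM: "K \<subseteq> M" by (auto simp: K_def)
    have Q: "{Q i c, Q i (\<not> c)} = i" if "i \<in> K" for i c
      using XY[OF that] unfolding Q_def R_def by (cases c) (auto simp: insert_commute)
    have T: "dist (Q i c) (Q i (\<not> c)) = dist (Q i True) (Q i False)" for i c
      by (cases c) (simp_all add: dist_commute)
    interpret star K R B h "\<lambda>i c j d. dist (Q i c) (Q j d)"
    proof
      show "dist (Q i c) (Q j d) = D (R i c) (R j d) (B j + side d (h j) - (B i + side c (h i)))" for i c j d
        unfolding Q_def dist_pol ..
    next
      fix i c assume i: "i \<in> K"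
      show "0 < R i c" "0 \<le> h i \<and> h i < pi / 3" using i rs h by (simp_all add: R_def)
      have "{a i, b i} = {Q i True, Q i False}" using ab(2)[of i] Q[OF i, of True] KM i by auto
      then consider "a i = Q i True" "b i = Q i False" | "a i = Q i False" "b i = Q i True"
        unfolding doubleton_eq_iff by blast
      then have "dist (Q i True) (Q i False) = dist (a i) (b i)" "dist (a i) z + dist (b i) z = R i True + R i False"
        using rs[OF i] by (cases; simp add: Q_def R_def dist_norm norm_pol norm_minus_commute)+
      then show "dist (Q i True) (Q i False) < c0 * (R i True + R i False)" using short[OF i] by simp
    next
      fix i j c assume ij: "i \<in> K" "j \<in> K" "i \<noteq> j"
      have "{Q i True, Q i (\<not> True)} \<in> M" "{Q j c, Q j (\<not> c)} \<in> M"
        "{Q i True, Q i (\<not> True)} \<noteq> {Q j c, Q j (\<not> c)}"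
        unfolding Q[OF ij(1)] Q[OF ij(2)] using ij KM by auto
      from local_max_pair[OF loc this]
      show "dist (Q i True) (Q j c) + dist (Q i False) (Q j (\<not> c))
          \<le> dist (Q i True) (Q i False) + dist (Q j True) (Q j False)"
        unfolding T by simp
    next
      fix i j k c d e assume ijk: "i \<in> K" "j \<in> K" "k \<in> K" "i \<noteq> j" "j \<noteq> k" "k \<noteq> i"
      have "{Q i c, Q i (\<not> c)} \<in> M" "{Q j d, Q j (\<not> d)} \<in> M" "{Q k e, Q k (\<not> e)} \<in> M"
        "{Q i c, Q i (\<not> c)} \<noteq> {Q j d, Q j (\<not> d)}" "{Q j d, Q j (\<not> d)} \<noteq> {Q k e, Q k (\<not> e)}"
        "{Q k e, Q k (\<not> e)} \<noteq> {Q i c, Q i (\<not> c)}"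
        unfolding Q[OF ijk(1)] Q[OF ijk(2)] Q[OF ijk(3)] using ijk KM by auto
      from local_max_triple[OF loc this]
      show "dist (Q i c) (Q j d) + dist (Q j (\<not> d)) (Q k e) + dist (Q k (\<not> e)) (Q i (\<not> c))
          \<le> dist (Q i True) (Q i False) + dist (Q j True) (Q j False) + dist (Q k True) (Q k False)"
        unfolding T .
    qed
    \<comment> \<open>The gradient of the excess at \<open>z\<close>; by \<open>sgn\<close> it is a
      negative multiple of the bisector direction.\<close>
    define u where "u e = - c0 *\<^sub>R (sgn (a e - z) + sgn (b e - z))" for e
    have u: "u e \<bullet> v = - (c0 * (sgn (a e - z) \<bullet> v + sgn (b e - z) \<bullet> v))" for e v
      by (simp add: u_def inner_add_left)
    have "0 \<in> convex hull (u ` K)"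
      unfolding K_def F_def
    proof (rule minimax_critical)
      show "finite M" "M \<noteq> {}" by fact+
      show "isCont (f e) z" for e using cont[of UNIV e] by (simp add: continuous_on_eq_continuous_at)
      show "Max ((\<lambda>e. f e z) ` M) \<le> Max ((\<lambda>e. f e x) ` M)" for x using z unfolding F_def .
      fix e assume "e \<in> M" "f e z = Max ((\<lambda>e. f e z) ` M)"
      then have e: "e \<in> K" by (simp add: K_def F_def)
      have "(f e has_derivative (\<lambda>v. c0 * (- sgn (a e - z) \<bullet> v + - sgn (b e - z) \<bullet> v) - 0)) (at z)"
        unfolding f_def
        by (intro has_derivative_dist off e has_derivative_mult_right has_derivative_add has_derivative_diff has_derivative_const)
      then show "(f e has_derivative (\<lambda>v. u e \<bullet> v)) (at z)"
        by (rule has_derivative_eq_rhs) (rule ext, simp only: u, simp add: field_simps)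
    qed
    \<comment> \<open>Caratheodory in the plane: three gradients suffice.\<close>
    then have "\<exists>S. finite S \<and> S \<subseteq> u ` K \<and> card S \<le> DIM(point) + 1 \<and> 0 \<in> convex hull S"
      by (simp only: caratheodory[of "u ` K"] mem_Collect_eq)
    then obtain S where S: "finite S" "S \<subseteq> u ` K" "card S \<le> 3" "0 \<in> convex hull S"
      by (elim exE conjE) simp
    have "\<exists>q. (\<forall>v\<in>S. 0 \<le> q v) \<and> sum q S = 1 \<and> (\<Sum>v\<in>S. q v *\<^sub>R v) = 0"
      using S(4) unfolding convex_hull_finite[OF S(1)] mem_Collect_eq .
    then obtain q where "\<forall>v\<in>S. 0 \<le> q v" and q: "sum q S = 1" "(\<Sum>v\<in>S. q v *\<^sub>R v) = 0"
      by (elim exE conjE)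
    then have q_ge: "0 \<le> q v" if "v \<in> S" for v using that by simp
    \<comment> \<open>Selects one edge for each gradient, since several edges may share a
      gradient.\<close>
    define g where "g = inv_into K u"
    have g: "g v \<in> K" "u (g v) = v" if "v \<in> S" for v
      using S(2) that unfolding g_def by (auto intro: inv_into_into f_inv_into_f)
    \<comment> \<open>\<open>balanced_false\<close> needs strictly positive weights: vanishing
      coefficients are dropped, and \<open>t\<close> absorbs the positive factor
      \<open>c0 * (2 * cos (h (g v)))\<close> between gradient and unit bisector.\<close>
    define T where "T = {v \<in> S. 0 < q v}"
    define t where "t v = c0 * q v * (2 * cos (h (g v)))" for v
    have TS: "T \<subseteq> S" by (auto simp: T_def)
    have "(\<Sum>v\<in>T. q v *\<^sub>R v) = (\<Sum>v\<in>S. q v *\<^sub>R v)"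
      using S(1) q_ge by (intro sum.mono_neutral_left) (force simp: T_def)+
    also have "\<dots> = 0" by (fact q(2))
    finally have zero: "(\<Sum>v\<in>T. q v *\<^sub>R v) = 0" .
    have qv: "q v *\<^sub>R v = - (t v *\<^sub>R pol 1 (B (g v)))" if "v \<in> T" for v
    proof -
      have v: "v \<in> S" using that TS by blast
      have "q v *\<^sub>R v = q v *\<^sub>R u (g v)" unfolding g(2)[OF v] ..
      also have "\<dots> = - (t v *\<^sub>R pol 1 (B (g v)))"
        unfolding u_def t_def sgn[OF g(1)[OF v]] by simp
      finally show ?thesis .
    qed
    have sum0: "(\<Sum>v\<in>T. t v *\<^sub>R pol 1 (B (g v))) = 0"
      using zero by (simp add: qv sum_negf)
    show False
    proof (rule balanced_false[of T g t])
      show "finite T" using S(1) TS finite_subset by blast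
      show "card T \<le> 3" using S(1,3) TS card_mono order_trans by blast
      show "T \<noteq> {}"
      proof
        assume "T = {}"
        then have "sum q S \<le> 0" by (intro sum_nonpos) (auto simp: T_def not_less)
        then show False using q(1) by simp
      qed
      show "inj_on g T" using g(2) TS by (metis inj_onI subsetD)
      show "g ` T \<subseteq> K" using g(1) TS by auto
      show "0 < t v" if "v \<in> T" for v
      proof -
        have "g v \<in> K" using g(1) that TS by blast
        then have "0 < cos (h (g v))"
          using h[of "g v"] pi_gt_zero by (intro cos_gt_zero_pi) linarith+
        then show ?thesis using that by (simp add: t_def T_def)
      qed
      show "(\<Sum>v\<in>T. t v * sin (B (g v))) = 0" "(\<Sum>v\<in>T. t v * cos (B (g v))) = 0"
        using arg_cong[OF sum0, of "\<lambda>v. v $ 2"] arg_cong[OF sum0, of "\<lambda>v. v $ 1"] by simp_all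
    qed
  qed
  then have "\<forall>e\<in>M. f e z \<le> 0" using F_ge order_trans by blast
  moreover have "(\<Sum>x\<in>e. dist x z) = dist (a e) z + dist (b e) z" "edge_len e = dist (a e) (b e)" if e: "e \<in> M" for e
  proof -
    have "(\<Sum>x\<in>{a e, b e}. dist x z) = dist (a e) z + dist (b e) z" using ab(1)[OF e] by simp
    then show "(\<Sum>x\<in>e. dist x z) = dist (a e) z + dist (b e) z" unfolding ab(2)[OF e, symmetric] .
    show "edge_len e = dist (a e) (b e)"
      using edge_len_pair[of "a e" "b e"] unfolding ab(2)[OF e, symmetric] .
  qed
  ultimately have "\<forall>e\<in>M. c0 * (\<Sum>x\<in>e. dist x z) \<le> edge_len e"
    unfolding f_def by simp
  then show ?thesis by (rule exI)
qed simp

section \<open>Comparison of the two matchings through the distances to the centre\<close>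

theorem theorem5:
  fixes P :: "point set" and M Mstar :: "point set set"
  assumes "finite P" and "even (card P)"
    and "local_max 3 P M"
    and "max_matching P Mstar"
  shows "w M \<ge> sqrt 3 / 2 * w Mstar"
proof -
  have M: "perfect_matching P M" and N: "perfect_matching P Mstar"
    using assms by (simp_all add: local_max_def max_matching_def)
  obtain z where z: "\<forall>e\<in>M. c0 * (\<Sum>x\<in>e. dist x z) \<le> edge_len e"
    using exists_center assms(1,3) by blast
  have "w Mstar \<le> (\<Sum>e\<in>Mstar. \<Sum>x\<in>e. dist x z)"
    unfolding w_def
  proof (rule sum_mono)
    fix e assume "e \<in> Mstar"
    then obtain a b where "a \<noteq> b" "e = {a, b}" by (rule matching_edge[OF N])
    then show "edge_len e \<le> (\<Sum>x\<in>e. dist x z)"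
      using dist_triangle2[of a b z] by (simp add: edge_len_pair)
  qed
  also have "\<dots> = (\<Sum>e\<in>M. \<Sum>x\<in>e. dist x z)"
    unfolding matching_sum[OF N] matching_sum[OF M] ..
  finally have "c0 * w Mstar \<le> c0 * (\<Sum>e\<in>M. \<Sum>x\<in>e. dist x z)"
    by (rule mult_left_mono) simp
  also have "\<dots> = (\<Sum>e\<in>M. c0 * (\<Sum>x\<in>e. dist x z))"
    by (rule sum_distrib_left)
  also have "\<dots> \<le> w M"
    unfolding w_def using z by (intro sum_mono) auto
  finally show ?thesis .
qed

end
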